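(* Let $T$ be a finite set with $|T| = n$, and call a \emph{game on $T$} a strict partial order $<$ on $T$ (so that distinct games on $T$ are exactly distinct strict partial orders on $T$). Then the number $G(n)$ of distinct games on $T$ satisfies $$G(n) \sim \sum_{i=1}^{n} \sum_{j=1}^{n-i} \binom{n}{i} \binom{n-i}{j} (2^i - 1)^{j}(2^{j}-1)^{n-i-j} \qquad (n \to \infty),$$ i.e. the ratio of the two sides tends to $1$. *)

theory Defs
  imports Complex_Main
begin

definition game_on :: "'a set \<Rightarrow> 'a rel \<Rightarrow> bool" where
  "game_on T R \<longleftrightarrow> R \<subseteq> T \<times> T \<and> irrefl_on T R \<and> trans R"

definition G :: "nat \<Rightarrow> nat" where
  "G n = card {R. game_on {0..<n} R}"

end

theory Submission
  imports Defs "HOL-Library.FuncSet"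
begin

text \<open>
  Let \<open>S(n)\<close> be the double sum. The layered relations it counts give distinct partial orders, so the point is the upper
  bound. A partial order is determined by its covering digraph, and covering digraphs are tame: they
  have no 2-cycle, their underlying graph is triangle-free, and the ends of a directed path with three
  edges are not adjacent. It suffices to bound the number \<open>h(n)\<close> of tame digraphs.

  If a tame digraph has a vertex whose neighbourhood can be encoded, given the rest of the digraph, by
  \<open>(1/2 - c) n\<close> bits, then deleting this vertex shows that there are at most
  \<open>h(n - 1) 2^((1/2 - c) n)\<close> such digraphs. If there is no such vertex, then the second neighbourhoods
  of the ends of an edge are nearly complementary sets of size about \<open>n/2\<close>, and this forces the
  underlying graph to be bipartite. Moreover, either there is no directed path with three edges and the
  digraph has three layers, or all but a small part of the digraph is oriented from one side of the bipartition to the other. The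
  two-layer digraphs, and the three-layer ones in which some vertex of the middle layer has no lower
  neighbour, are negligible by direct counting. Comparing with \<open>2^(n^2/4 + 3n/2)\<close>, which is the order of
  magnitude of the double sum up to a polynomial factor, turns the resulting recursion
  \<open>h(n) \<le> S(n) + h(n - 1) 2^((1/2 - c) n) + o(S(n))\<close> into \<open>h(n) \<sim> S(n)\<close>.
\<close>

section \<open>Tame digraphs\<close>

text \<open>A full second neighbourhood may take linearly many vertices to name, and naming them
  would cost more bits than the encoding saves. The sets used here are the neighbours of boundedly
  many vertices: a greedy choice misses only a tiny part of each relevant neighbourhood and costs a
  polynomial factor. The constants are chosen backwards. Listing exceptions at rate \<open>g\<close>
  costs about \<open>g\<close> log(1/\<open>g\<close>) bits per vertex, and the saving
  \<open>d\<close> has to exceed that. The final error, \<open>n / 60\<close>, must stay below the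
  minimal degree \<open>n / 32\<close>; this permits the saving 1/64 with exception rate 7/8192;
  that rate must absorb twice the previous saving, which is therefore 1/4096, and this in turn
  permits the exception rate 1/131072. The layered relations serve the two bounds differently. For
  the upper bound they are digraphs without edges between the outer layers; for the lower bound all
  pairs from the lowest to the highest layer are added to obtain an order. The covering digraph of
  that order need not be the relation it came from, so the two bounds rest on separate
  injections.\<close>

definition nb :: "'a rel \<Rightarrow> 'a \<Rightarrow> 'a set" where
  "nb r v = r `` {v} \<union> r\<inverse> `` {v}"

definition nbs :: "'a rel \<Rightarrow> 'a set \<Rightarrow> 'a set" where
  "nbs r Q = (\<Union>q\<in>Q. nb r q)"

text \<open>A relaxation of being the covering digraph of a partial order that passes to subdigraphs,
  so that vertices can be deleted.\<close>

definition tame :: "'a rel \<Rightarrow> bool" where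
  "tame r \<longleftrightarrow> (\<forall>x y. (x, y) \<in> r \<longrightarrow> (y, x) \<notin> r)
     \<and> (\<forall>x y z. y \<in> nb r x \<longrightarrow> z \<in> nb r y \<longrightarrow> z \<notin> nb r x)
     \<and> (\<forall>a b c d. (a, b) \<in> r \<longrightarrow> (b, c) \<in> r \<longrightarrow> (c, d) \<in> r \<longrightarrow> d \<notin> nb r a)"

definition tames :: "'a set \<Rightarrow> 'a rel set" where
  "tames V = {r. r \<subseteq> V \<times> V \<and> tame r}"

definition del :: "'a rel \<Rightarrow> 'a \<Rightarrow> 'a rel" where
  "del r w = {(x, y) \<in> r. x \<noteq> w \<and> y \<noteq> w}"

lemma mem_nb: "y \<in> nb r x \<longleftrightarrow> (x, y) \<in> r \<or> (y, x) \<in> r"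
  by (auto simp: nb_def)

lemma nb_sym: "y \<in> nb r x \<longleftrightarrow> x \<in> nb r y"
  by (auto simp: mem_nb)

lemma tame_asym: "tame r \<Longrightarrow> (x, y) \<in> r \<Longrightarrow> (y, x) \<notin> r"
  unfolding tame_def by metis

lemma tame_triangle: "tame r \<Longrightarrow> y \<in> nb r x \<Longrightarrow> z \<in> nb r y \<Longrightarrow> z \<notin> nb r x"
  unfolding tame_def by metis

lemma tame_path: "tame r \<Longrightarrow> (a, b) \<in> r \<Longrightarrow> (b, c) \<in> r \<Longrightarrow> (c, d) \<in> r \<Longrightarrow> d \<notin> nb r a"
  unfolding tame_def by metis

lemma tame_irrefl: "tame r \<Longrightarrow> x \<notin> nb r x"
  using tame_asym[of r x x] by (auto simp: mem_nb)

lemma tameI: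
  assumes "\<And>x y. (x, y) \<in> r \<Longrightarrow> (y, x) \<notin> r"
    and "\<And>x y z. y \<in> nb r x \<Longrightarrow> z \<in> nb r y \<Longrightarrow> z \<notin> nb r x"
    and "\<And>a b c d. (a, b) \<in> r \<Longrightarrow> (b, c) \<in> r \<Longrightarrow> (c, d) \<in> r \<Longrightarrow> d \<notin> nb r a"
  shows "tame r"
  unfolding tame_def by (intro conjI allI impI, fact assms(1), fact assms(2), fact assms(3))

lemma tame_mono:
  assumes "tame r" "s \<subseteq> r" shows "tame s"
proof (rule tameI)
  have nb: "y \<in> nb r x" if "y \<in> nb s x" for x y
    using that assms(2) by (auto simp: mem_nb)
  show "(y, x) \<notin> s" if "(x, y) \<in> s" for x y
    using that assms tame_asym by (metis subsetD)
  show "z \<notin> nb s x" if "y \<in> nb s x" "z \<in> nb s y" for x y z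
    using tame_triangle[OF assms(1)] nb that by metis
  show "d \<notin> nb s a" if "(a, b) \<in> s" "(b, c) \<in> s" "(c, d) \<in> s" for a b c d
    using tame_path[OF assms(1)] nb that assms(2) by (metis subsetD)
qed

lemma nb_converse: "nb (r\<inverse>) = nb r"
  by (auto simp: nb_def fun_eq_iff)

lemma nbs_converse: "nbs (r\<inverse>) = nbs r"
  by (auto simp: nbs_def nb_converse fun_eq_iff)

lemma tame_converse:
  assumes "tame r" shows "tame (r\<inverse>)"
proof (rule tameI)
  show "(y, x) \<notin> r\<inverse>" if "(x, y) \<in> r\<inverse>" for x y
    using that tame_asym[OF assms, of y x] by simp
  show "z \<notin> nb (r\<inverse>) x" if "y \<in> nb (r\<inverse>) x" "z \<in> nb (r\<inverse>) y" for x y z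
    using that tame_triangle[OF assms, of y x z] unfolding nb_converse by simp
  show "d \<notin> nb (r\<inverse>) a" if "(a, b) \<in> r\<inverse>" "(b, c) \<in> r\<inverse>" "(c, d) \<in> r\<inverse>" for a b c d
    using that tame_path[OF assms, of d c b a] nb_sym[of a r d] unfolding nb_converse by simp
qed

lemma mem_del: "(x, y) \<in> del r w \<longleftrightarrow> (x, y) \<in> r \<and> x \<noteq> w \<and> y \<noteq> w"
  by (simp add: del_def)

lemma del_converse: "del (r\<inverse>) w = (del r w)\<inverse>"
  by (auto simp: del_def)

lemma del_subset: "del r w \<subseteq> r"
  by (auto simp: del_def)

lemma del_tames: "r \<in> tames V \<Longrightarrow> del r w \<in> tames (V - {w})"
  using tame_mono[OF _ del_subset] unfolding tames_def by (auto simp: mem_del)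

lemma nb_del: "q \<noteq> w \<Longrightarrow> nb (del r w) q = nb r q - {w}"
  by (auto simp: del_def nb_def)

lemma nbs_del: "w \<notin> Q \<Longrightarrow> nbs (del r w) Q = nbs r Q - {w}"
  unfolding nbs_def using nb_del[of _ w r] by fast

lemma finite_tames: "finite V \<Longrightarrow> finite (tames V)"
  by (rule finite_subset[of _ "Pow (V \<times> V)"]) (auto simp: tames_def)

lemma nb_subset: "r \<subseteq> V \<times> V \<Longrightarrow> nb r v \<subseteq> V"
  by (auto simp: nb_def)

lemma nbs_subset: "r \<subseteq> V \<times> V \<Longrightarrow> nbs r Q \<subseteq> V"
  unfolding nbs_def by (intro UN_least nb_subset)

text \<open>If \<open>q\<close> and \<open>y\<close> are neighbours of \<open>w\<close> with a further common neighbour \<open>x\<close>, then the orientations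
  of \<open>qw\<close>, \<open>qx\<close> and \<open>xy\<close> leave at most one orientation of \<open>yw\<close>, since a path with three
  edges must not close up to a 4-cycle. So the undirected neighbourhood of \<open>w\<close> together with boundedly
  many oriented edges at \<open>w\<close> determines all orientations at \<open>w\<close>.\<close>

lemma orientation_unique_aux:
  assumes t1: "tame r1" and t2: "tame r2" and d: "del r1 w = del r2 w"
    and Qm: "Qm \<times> {w} \<subseteq> r1" "Qm \<times> {w} \<subseteq> r2" and Qp: "{w} \<times> Qp \<subseteq> r1" "{w} \<times> Qp \<subseteq> r2"
    and x: "x \<noteq> w" "x \<in> nbs r1 (Qm \<union> Qp)" "x \<in> nb r1 y"
    and y: "(y, w) \<in> r1" "(w, y) \<in> r2"
  shows False
proof -
  have ir: "(u, u) \<notin> r1" "(u, u) \<notin> r2" for u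
    using tame_irrefl[OF t1] tame_irrefl[OF t2] by (auto simp: mem_nb)
  have eq: "(u, v) \<in> r1 \<longleftrightarrow> (u, v) \<in> r2" if "u \<noteq> w" "v \<noteq> w" for u v
    using d that mem_del by metis
  obtain q where q: "q \<in> Qm \<union> Qp" "x \<in> nb r1 q"
    using x(2) by (auto simp: nbs_def)
  have wq: "(q, w) \<in> r1 \<and> (q, w) \<in> r2 \<or> (w, q) \<in> r1 \<and> (w, q) \<in> r2"
    using q(1) Qm Qp by (metis UnE mem_Sigma_iff singletonI subsetD)
  have yw: "y \<noteq> w" using y(1) ir(1) by metis
  have qw: "q \<noteq> w" using wq ir(1) by metis
  have xy: "(x, y) \<in> r1 \<and> (x, y) \<in> r2 \<or> (y, x) \<in> r1 \<and> (y, x) \<in> r2"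
    using x(3) eq[OF x(1) yw] eq[OF yw x(1)] unfolding mem_nb by argo
  have xq: "(x, q) \<in> r1 \<and> (x, q) \<in> r2 \<or> (q, x) \<in> r1 \<and> (q, x) \<in> r2"
    using q(2) eq[OF x(1) qw] eq[OF qw x(1)] unfolding mem_nb by argo
  have p1: "(a, b) \<in> r1 \<Longrightarrow> (b, c) \<in> r1 \<Longrightarrow> (c, d) \<in> r1 \<Longrightarrow> (a, d) \<notin> r1 \<and> (d, a) \<notin> r1" for a b c d
    using tame_path[OF t1, of a b c d] by (auto simp: mem_nb)
  have p2: "(a, b) \<in> r2 \<Longrightarrow> (b, c) \<in> r2 \<Longrightarrow> (c, d) \<in> r2 \<Longrightarrow> (a, d) \<notin> r2 \<and> (d, a) \<notin> r2" for a b c d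
    using tame_path[OF t2, of a b c d] by (auto simp: mem_nb)
  \<comment> \<open>Of the three common edges of the 4-cycle \<open>w\<close>, \<open>q\<close>,
    \<open>x\<close>, \<open>y\<close>, at least two run the same way round. The orientation of the
    fourth edge that agrees with them produces a directed path of three edges with adjacent ends,
    and each orientation occurs in one of the two digraphs.\<close>
  show False
    using wq xq xy y p1 p2 by meson
qed

lemma orientation_unique:
  assumes t1: "tame r1" and t2: "tame r2" and d: "del r1 w = del r2 w"
    and Qm: "Qm \<times> {w} \<subseteq> r1" "Qm \<times> {w} \<subseteq> r2" and Qp: "{w} \<times> Qp \<subseteq> r1" "{w} \<times> Qp \<subseteq> r2"
    and n: "nb r1 w = nb r2 w"
    and c: "\<And>y. y \<in> nb r1 w \<Longrightarrow> \<exists>x. x \<noteq> w \<and> x \<in> nbs r1 (Qm \<union> Qp) \<and> x \<in> nb r1 y"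
  shows "r1 = r2"
proof -
  have ir: "(u, u) \<notin> r1" "(u, u) \<notin> r2" for u
    using tame_irrefl[OF t1] tame_irrefl[OF t2] by (auto simp: mem_nb)
  have wQ: "w \<notin> Qm \<union> Qp"
    using Qm(1) Qp(1) ir(1)[of w] by (metis UnE mem_Sigma_iff singletonI subsetD)
  have nbs: "nbs r1 (Qm \<union> Qp) - {w} = nbs r2 (Qm \<union> Qp) - {w}"
    using d nbs_del[OF wQ] by metis
  have nby: "nb r1 y - {w} = nb r2 y - {w}" if "y \<noteq> w" for y
    using d nb_del[OF that] by metis
  have yw: "y \<noteq> w" if "y \<in> nb r1 w" for y
    using that ir by (auto simp: mem_nb)
  have A: "(y, w) \<in> r1 \<longleftrightarrow> (y, w) \<in> r2" if y: "y \<in> nb r1 w" for y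
  proof -
    obtain x where x: "x \<noteq> w" "x \<in> nbs r1 (Qm \<union> Qp)" "x \<in> nb r1 y"
      using c[OF y] by blast
    have x': "x \<in> nbs r2 (Qm \<union> Qp)" "x \<in> nb r2 y"
      using x nbs nby[OF yw[OF y]] by (metis Diff_iff singletonD)+
    have "\<not> ((y, w) \<in> r1 \<and> (w, y) \<in> r2)"
      using orientation_unique_aux[OF t1 t2 d Qm Qp x] by blast
    moreover have "\<not> ((y, w) \<in> r2 \<and> (w, y) \<in> r1)"
      using orientation_unique_aux[OF t2 t1 d[symmetric] Qm(2,1) Qp(2,1) x(1) x'] by blast
    moreover have "(y, w) \<in> r1 \<or> (w, y) \<in> r1" "(y, w) \<in> r2 \<or> (w, y) \<in> r2"
      using y n mem_nb by metis+
    ultimately show ?thesis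
      using t1 t2 tame_asym by metis
  qed
  have B: "(w, y) \<in> r1 \<longleftrightarrow> (w, y) \<in> r2" if y: "y \<in> nb r1 w" for y
    using A[OF y] y n tame_asym[OF t1] tame_asym[OF t2] mem_nb by metis
  have "(x, y) \<in> r1 \<longleftrightarrow> (x, y) \<in> r2" for x y
  proof (cases "x = w \<or> y = w")
    case True
    then show ?thesis using A B n mem_nb by metis
  next
    case False
    then show ?thesis using d mem_del by metis
  qed
  then show ?thesis by auto
qed

text \<open>Take a largest \<open>Q\<close> for which \<open>nbs r Q\<close> has at least
  \<open>g\<close> points per vertex of \<open>Q\<close>. A vertex \<open>y\<close> with
  \<open>g\<close> neighbours outside \<open>nbs r Q\<close> could be added to it.\<close>

lemma greedy_cover:
  fixes g :: real
  assumes V: "finite V" "r \<subseteq> V \<times> V" and S: "S \<subseteq> V" and g: "g > 0"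
  obtains Q where "Q \<subseteq> S" "card Q * g \<le> card V" "\<And>y. y \<in> S \<Longrightarrow> card (nb r y - nbs r Q) < g"
proof -
  have fin: "finite (nbs r Q)" for Q
    using nbs_subset[OF V(2)] V(1) finite_subset by blast
  have finnb: "finite (nb r Q)" for Q
    using nb_subset[OF V(2)] V(1) finite_subset by blast
  have finS: "finite S" using S V(1) finite_subset by blast
  define F where "F = {Q. Q \<subseteq> S \<and> card Q * g \<le> card (nbs r Q)}"
  have "finite F" by (rule finite_subset[of _ "Pow S"]) (auto simp: F_def finS)
  moreover have "{} \<in> F" by (auto simp: F_def)
  ultimately obtain Q where Q: "Q \<in> F" "\<And>P. P \<in> F \<Longrightarrow> card P \<le> card Q"
    using obtains_MAX[of F card] by (metis empty_iff Max_ge finite_imageI imageI)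
  have QS: "Q \<subseteq> S" "finite Q" using Q(1) finS finite_subset by (auto simp: F_def)
  have "card Q * g \<le> card (nbs r Q)" using Q(1) by (simp add: F_def)
  also have "\<dots> \<le> card V" using nbs_subset[OF V(2)] card_mono[OF V(1)] by force
  finally have 1: "card Q * g \<le> card V" .
  have "card (nb r y - nbs r Q) < g" if y: "y \<in> S" for y
  proof (rule ccontr)
    assume neg: "\<not> card (nb r y - nbs r Q) < g"
    have yQ: "y \<notin> Q"
    proof
      assume "y \<in> Q"
      then have "nb r y - nbs r Q = {}" by (auto simp: nbs_def)
      then have "card (nb r y - nbs r Q) = 0" by (metis card.empty)
      then show False using neg g by linarith
    qed
    have "nbs r (insert y Q) = nbs r Q \<union> (nb r y - nbs r Q)" by (auto simp: nbs_def)
    then have "card (nbs r (insert y Q)) = card (nbs r Q) + card (nb r y - nbs r Q)"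
      using fin finnb by (metis card_Un_disjoint Diff_disjoint finite_Diff)
    then have "card (insert y Q) * g \<le> card (nbs r (insert y Q))"
      using neg Q(1) yQ QS by (auto simp: F_def algebra_simps)
    then have "insert y Q \<in> F" using y QS by (auto simp: F_def)
    then show False using Q(2)[of "insert y Q"] yQ QS by simp
  qed
  then show ?thesis using that QS 1 by blast
qed

section \<open>Counting families of small sets\<close>

lemma card_UN_bound:
  assumes "finite I" "real (card I) \<le> a" "\<And>i. i \<in> I \<Longrightarrow> real (card (A i)) \<le> b" "b \<ge> 0"
  shows "real (card (\<Union>i\<in>I. A i)) \<le> a * b"
proof -
  have "real (card (\<Union>i\<in>I. A i)) \<le> real (\<Sum>i\<in>I. card (A i))"
    using card_UN_le[OF assms(1)] by (simp only: of_nat_le_iff)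
  also have "\<dots> \<le> (\<Sum>i\<in>I. b)" unfolding of_nat_sum using assms(3) by (rule sum_mono)
  also have "\<dots> \<le> a * b" using assms(2,4) by (simp add: mult_right_mono)
  finally show ?thesis .
qed

lemma sum_power_card_Pow:
  assumes "finite V" shows "(\<Sum>E\<in>Pow V. (x::real) ^ card E) = (1 + x) ^ card V"
  using assms
proof (induction V rule: finite_induct)
  case (insert v V)
  have "(\<Sum>E\<in>Pow (insert v V). x ^ card E)
      = (\<Sum>E\<in>Pow V. x ^ card E) + (\<Sum>E\<in>insert v ` Pow V. x ^ card E)"
    unfolding Pow_insert using insert by (intro sum.union_disjoint) auto
  also have "(\<Sum>E\<in>insert v ` Pow V. x ^ card E) = (\<Sum>E\<in>Pow V. x ^ card (insert v E))"
    using insert by (intro sum.reindex_cong[of "insert v"]) (auto simp: inj_on_def)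
  also have "\<dots> = (\<Sum>E\<in>Pow V. x * x ^ card E)"
    using insert by (intro sum.cong refl) (metis PowD card_insert_disjoint finite_subset power_Suc subsetD)
  finally show ?case using insert by (simp add: sum_distrib_left[symmetric] algebra_simps)
qed simp

text \<open>Weigh \<open>E\<close> by \<open>x ^ card E\<close> with \<open>x = (1/2) ^ m\<close>.
  All subsets together weigh \<open>(1 + x) ^ n\<close>, at most \<open>2 powr (2 * x * n)\<close>,
  and each counted set weighs at least \<open>2 powr (- m * g * n)\<close>. The parameter
  \<open>m\<close> is free and is matched to \<open>g\<close> later, with the values 4, 8 and
  14.\<close>

lemma card_small_subsets:
  fixes g :: real
  assumes "finite V"
  shows "real (card {E. E \<subseteq> V \<and> real (card E) \<le> g * card V}) \<le> 2 powr ((m * g + 2 / 2 ^ m) * card V)"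
proof -
  define n where "n = card V"
  define x where "x = (1/2::real) ^ m"
  let ?F = "{E. E \<subseteq> V \<and> real (card E) \<le> g * n}"
  have x0: "x > 0" by (simp add: x_def)
  have xp: "x ^ k = 2 powr (- (real m * k))" for k
    unfolding x_def by (simp add: powr_minus powr_realpow[symmetric] power_divide inverse_eq_divide powr_powr)
  have fin: "finite ?F" using assms by (auto intro: finite_subset[of _ "Pow V"])
  have "real (card ?F) * 2 powr (- (m * (g * n))) = (\<Sum>E\<in>?F. 2 powr (- (m * (g * n))))" by simp
  also have "\<dots> \<le> (\<Sum>E\<in>?F. x ^ card E)"
    unfolding xp by (intro sum_mono) (auto intro!: mult_left_mono)
  also have "\<dots> \<le> (\<Sum>E\<in>Pow V. x ^ card E)"
    using assms x0 by (intro sum_mono2) auto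
  also have "\<dots> = (1 + x) ^ n" using sum_power_card_Pow[OF assms] by (simp add: n_def)
  also have "\<dots> \<le> (2 powr (2 * x)) ^ n"
  proof (rule power_mono)
    have "1 + x \<le> exp 1 powr x" by (simp add: powr_def)
    also have "\<dots> \<le> 4 powr x" using exp_le x0 by (intro powr_mono2) auto
    also have "(4::real) powr x = (2 powr 2) powr x" by simp
    also have "\<dots> = 2 powr (2 * x)" by (rule powr_powr)
    finally show "1 + x \<le> 2 powr (2 * x)" .
  qed (use x0 in simp)
  also have "\<dots> = 2 powr (2 * x * n)" by (simp add: powr_power mult_ac)
  finally have "real (card ?F) * 2 powr (- (m * (g * n))) \<le> 2 powr (2 * x * n)" .
  then have "real (card ?F) \<le> 2 powr (2 * x * n) * 2 powr (m * (g * n))"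
    by (simp add: powr_minus field_simps)
  also have "\<dots> = 2 powr ((m * g + 2 / 2 ^ m) * n)"
    by (simp add: powr_add[symmetric] x_def power_divide algebra_simps)
  finally show ?thesis by (simp add: n_def)
qed

lemma card_subsets_le_power:
  assumes "finite V"
  shows "card {Q. Q \<subseteq> V \<and> card Q \<le> k} \<le> (card V + 1) ^ k"
proof (induction k)
  case 0
  have "{Q. Q \<subseteq> V \<and> card Q \<le> 0} = {{}}"
    using assms finite_subset[OF _ assms] by (auto simp del: subset_empty)
  then show ?case by simp
next
  case (Suc k)
  let ?A = "\<lambda>k. {Q. Q \<subseteq> V \<and> card Q \<le> k}"
  have fin: "finite (?A k)" for k using assms by (auto intro: finite_subset[of _ "Pow V"])
  have "?A (Suc k) \<subseteq> ?A k \<union> (\<lambda>(v, Q). insert v Q) ` (V \<times> ?A k)"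
  proof
    fix Q assume Q: "Q \<in> ?A (Suc k)"
    show "Q \<in> ?A k \<union> (\<lambda>(v, Q). insert v Q) ` (V \<times> ?A k)"
    proof (cases "Q = {}")
      case False
      then obtain v where v: "v \<in> Q" by auto
      have "finite Q" using Q assms finite_subset by auto
      then have "Q - {v} \<in> ?A k" "v \<in> V" using Q v by (auto simp: card_Diff_singleton)
      moreover have "Q = (\<lambda>(v, Q). insert v Q) (v, Q - {v})" using v by auto
      ultimately show ?thesis by blast
    qed simp
  qed
  then have "card (?A (Suc k)) \<le> card (?A k \<union> (\<lambda>(v, Q). insert v Q) ` (V \<times> ?A k))"
    using fin assms by (intro card_mono) auto
  also have "\<dots> \<le> card (?A k) + card (V \<times> ?A k)"
    using fin assms by (intro order.trans[OF card_Un_le] add_left_mono card_image_le) auto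
  also have "\<dots> \<le> (card V + 1) * (card V + 1) ^ k"
    using Suc by (simp add: card_cartesian_product distrib_right add_mono mult_left_mono)
  finally show ?case by simp
qed

section \<open>Structure of typical tame digraphs\<close>

text \<open>Sets that are determined by the digraph and at most \<open>k\<close> vertices; there are only polynomially many.\<close>

definition definable :: "nat \<Rightarrow> 'a rel \<Rightarrow> 'a set \<Rightarrow> 'a set set" where
  "definable k r V = (\<Union>Q\<in>{Q. Q \<subseteq> V \<and> card Q \<le> k}.
     {nbs r Q, V - nbs r Q, r `` Q, r\<inverse> `` Q, r `` (r `` Q), r\<inverse> `` (r\<inverse> `` Q)})"

text \<open>If this fails at \<open>w\<close>, then the neighbourhood of \<open>w\<close> nearly avoids a set of size
  \<open>(1/2 + d) n\<close> known from the digraph without \<open>w\<close>. Hence there are at most about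
  \<open>2 powr ((1/2 - d) n)\<close> choices for it, exponentially fewer than the \<open>2 powr (n/2)\<close> by which the
  number of orders grows with each new element.\<close>

definition no_gap :: "nat \<Rightarrow> real \<Rightarrow> real \<Rightarrow> 'a set \<Rightarrow> 'a rel \<Rightarrow> bool" where
  "no_gap k g d V r \<longleftrightarrow> (\<forall>w\<in>V. \<forall>A\<in>definable k (del r w) V. \<forall>B\<in>definable k (del r w) V.
     real (card (nb r w \<inter> (A \<union> B))) \<le> g * card V \<longrightarrow> real (card (A \<union> B)) < (1/2 + d) * card V)"

lemma no_gapD:
  assumes "no_gap k g d V r" "w \<in> V" "A \<in> definable k (del r w) V" "B \<in> definable k (del r w) V"
    and "real (card (nb r w \<inter> (A \<union> B))) \<le> g * card V"
  shows "real (card (A \<union> B)) < (1/2 + d) * card V"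
  using assms unfolding no_gap_def by blast

lemma definable_converse: "definable k (r\<inverse>) V = definable k r V"
  unfolding definable_def nbs_converse converse_converse by (intro SUP_cong refl) auto

lemma no_gap_converse: "no_gap k g d V (r\<inverse>) = no_gap k g d V r"
  unfolding no_gap_def nb_converse del_converse definable_converse ..

lemma definable_nbs: "Q \<subseteq> V \<Longrightarrow> card Q \<le> k \<Longrightarrow> w \<notin> Q \<Longrightarrow> nbs r Q - {w} \<in> definable k (del r w) V"
  unfolding definable_def nbs_del[symmetric] by blast

lemma definable_nbs_compl:
  "Q \<subseteq> V \<Longrightarrow> card Q \<le> k \<Longrightarrow> w \<notin> Q \<Longrightarrow> V - (nbs r Q - {w}) \<in> definable k (del r w) V"
  unfolding definable_def nbs_del[symmetric] by blast

text \<open>Deleting \<open>w\<close> leaves the set unchanged because no edge that defines it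
  touches \<open>w\<close>; only then may the set be used in \<open>no_gap\<close> at
  \<open>w\<close>.\<close>

lemma definable_out:
  assumes "c \<in> V" "k \<ge> 1" "c \<noteq> w" "(c, w) \<notin> r"
  shows "r `` {c} \<in> definable k (del r w) V"
proof -
  have "r `` {c} = del r w `` {c}" using assms by (auto simp: mem_del)
  moreover have "{c} \<subseteq> V" "card {c} \<le> k" using assms by auto
  ultimately show ?thesis unfolding definable_def by blast
qed

lemma definable_in2:
  assumes "c \<in> V" "k \<ge> 1" "c \<noteq> w" "w \<notin> r\<inverse> `` {c}" "w \<notin> r\<inverse> `` (r\<inverse> `` {c})"
  shows "r\<inverse> `` (r\<inverse> `` {c}) \<in> definable k (del r w) V"
proof -
  have "r\<inverse> `` (r\<inverse> `` {c}) = (del r w)\<inverse> `` ((del r w)\<inverse> `` {c})"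
    using assms by (force simp: mem_del)
  moreover have "{c} \<subseteq> V" "card {c} \<le> k" using assms by auto
  ultimately show ?thesis unfolding definable_def by blast
qed

lemma card_le_card_add:
  assumes "finite B" "finite C" "A \<subseteq> B \<union> C"
  shows "real (card A) \<le> real (card B) + real (card C)"
  using card_mono[OF _ assms(3)] card_Un_le[of B C] assms by simp

text \<open>The first level of \<open>no_gap\<close> pins the size of second neighbourhoods to \<open>n/2\<close> up to an error
  that must be a valid exception rate \<open>7/8192\<close> for the second level.\<close>

locale robust =
  fixes V :: "'a set" and r :: "'a rel"
  assumes fin: "finite V" and tames: "r \<in> tames V" and large: "real (card V) \<ge> 10 ^ 8"
    and mindeg: "v \<in> V \<Longrightarrow> real (card (nb r v)) \<ge> card V / 32"
    and gap1: "no_gap 300000 (1/131072) (1/4096) V r"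
    and gap2: "no_gap 300000 (7/8192) (1/64) V r"
begin

abbreviation n :: real where "n \<equiv> real (card V)"

lemma sub: "r \<subseteq> V \<times> V" and tame: "tame r"
  using tames by (auto simp: tames_def)

lemma converse: "robust V (r\<inverse>)"
  using fin large mindeg gap1 gap2 tame_converse[OF tame] sub
  by unfold_locales (auto simp: tames_def nb_converse no_gap_converse)

lemma nb_sub: "nb r v \<subseteq> V"
  using nb_subset[OF sub] .

lemma nbs_sub: "nbs r Q \<subseteq> V"
  using nbs_subset[OF sub] .

lemma fin_sub: "A \<subseteq> V \<Longrightarrow> finite A"
  using fin finite_subset by auto

lemma nbs_avoid:
  assumes "Q \<subseteq> nb r w" shows "nb r w \<inter> nbs r Q = {}"
proof -
  have "y \<notin> nbs r Q" if y: "y \<in> nb r w" for y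
  proof
    assume "y \<in> nbs r Q"
    then obtain q where q: "q \<in> Q" "y \<in> nb r q" by (auto simp: nbs_def)
    then have "q \<in> nb r w" using assms by auto
    then show False using tame_triangle[OF tame _ q(2)] y by metis
  qed
  then show ?thesis by auto
qed

text \<open>There are no triangles, so \<open>nbs r Q\<close> avoids \<open>nb r w\<close> and
  \<open>no_gap\<close> applies with \<open>A = B\<close> and no exceptions. The summand 1 accounts
  for \<open>w\<close>, which is removed to make the set definable.\<close>

lemma nbs_upper:
  assumes w: "w \<in> V" and Q: "Q \<subseteq> nb r w" "card Q \<le> 300000"
  shows "real (card (nbs r Q)) \<le> (1/2 + 1/4096) * n + 1"
proof -
  have wQ: "w \<notin> Q" "Q \<subseteq> V" using Q(1) tame_irrefl[OF tame, of w] nb_sub[of w] by (metis subsetD, metis subset_trans)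
  have D: "nbs r Q - {w} \<in> definable 300000 (del r w) V"
    by (rule definable_nbs[OF wQ(2) Q(2) wQ(1)])
  have "nb r w \<inter> (nbs r Q - {w} \<union> (nbs r Q - {w})) = {}" using nbs_avoid[OF Q(1)] by auto
  then have "real (card (nbs r Q - {w} \<union> (nbs r Q - {w}))) < (1/2 + 1/4096) * n"
    by (intro no_gapD[OF gap1 w D D]) simp
  moreover have "real (card (nbs r Q)) \<le> real (card (nbs r Q - {w})) + real (card {w})"
    using fin_sub[OF nbs_sub] by (intro card_le_card_add) auto
  ultimately show ?thesis by simp
qed

section \<open>Second neighbourhoods generated by few vertices\<close>

definition cover :: "'a \<Rightarrow> 'a \<Rightarrow> 'a set \<Rightarrow> bool" where
  "cover v x Q \<longleftrightarrow> Q \<subseteq> nb r v - {x} \<and> card Q \<le> 131072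
     \<and> (\<forall>y\<in>nb r v - {x}. real (card (nb r y - nbs r Q)) \<le> n / 131072)"

definition Qf :: "'a \<Rightarrow> 'a \<Rightarrow> 'a set" where
  "Qf v x = (SOME Q. cover v x Q)"

text \<open>A stand-in for the second neighbourhood of \<open>v\<close>. Excluding \<open>x\<close>
  from the generators keeps the set definable after \<open>x\<close> has been deleted;
  \<open>R v v\<close> excludes nothing, since \<open>v\<close> is not its own neighbour.\<close>

definition R :: "'a \<Rightarrow> 'a \<Rightarrow> 'a set" where
  "R v x = nbs r (Qf v x)"

lemma cover_Qf: "cover v x (Qf v x)"
proof -
  obtain Q where Q: "Q \<subseteq> nb r v - {x}" "card Q * (n / 131072) \<le> card V"
    "\<And>y. y \<in> nb r v - {x} \<Longrightarrow> card (nb r y - nbs r Q) < n / 131072"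
  proof (rule greedy_cover[OF fin sub, of "nb r v - {x}" "n / 131072"])
    show "nb r v - {x} \<subseteq> V" using nb_sub[of v] by auto
    show "0 < n / 131072" using large by simp
  qed (rule that)
  have "real (card Q) \<le> 131072" using Q(2) large by (simp add: field_simps)
  then have "cover v x Q" using Q(1,3) unfolding cover_def by (auto intro: less_imp_le)
  then show ?thesis unfolding Qf_def by (rule someI)
qed

lemma Qf: "Qf v x \<subseteq> nb r v - {x}" "card (Qf v x) \<le> 131072" "Qf v x \<subseteq> V" "finite (Qf v x)"
  using cover_Qf[of v x] nb_sub[of v] fin_sub[of "Qf v x"] unfolding cover_def by blast+

lemma R_sub: "R v x \<subseteq> V"
  unfolding R_def by (rule nbs_sub)

lemma fin_R: "finite (R v x)"
  using fin_sub[OF R_sub] .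

lemma R_upper: "v \<in> V \<Longrightarrow> real (card (R v x)) \<le> (1/2 + 1/4096) * n + 1"
  unfolding R_def using Qf[of v x] by (intro nbs_upper[of v]) auto

text \<open>The degree of \<open>v\<close> exceeds the size of the cover, so some neighbour
  \<open>y\<close> of \<open>v\<close> is not a generator. The complement of \<open>R v x\<close>
  nearly misses \<open>nb r y\<close>, and \<open>no_gap\<close> at \<open>y\<close> bounds that
  complement.\<close>

lemma R_lower:
  assumes v: "v \<in> V" shows "real (card (R v x)) \<ge> (1/2 - 1/4096) * n"
proof -
  let ?Q = "Qf v x"
  have "card (insert x ?Q) \<le> 131073" using Qf[of v x] by (simp add: card_insert_if)
  moreover have "real (card (nb r v)) \<ge> 10 ^ 8 / 32" using mindeg[OF v] large by simp
  ultimately have "card (insert x ?Q) < card (nb r v)" by simp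
  then have "\<not> nb r v \<subseteq> insert x ?Q" using Qf(4) by (meson card_mono finite_insert leD)
  then obtain y where y: "y \<in> nb r v - {x}" "y \<notin> ?Q" by blast
  have yV: "y \<in> V" using y(1) nb_sub[of v] by auto
  let ?C = "V - (nbs r ?Q - {y})"
  have D: "?C \<in> definable 300000 (del r y) V"
    using Qf[of v x] y by (intro definable_nbs_compl) auto
  have "nb r y \<inter> (?C \<union> ?C) = nb r y - nbs r ?Q"
    using nb_sub[of y] tame_irrefl[OF tame, of y] by auto
  then have "real (card (nb r y \<inter> (?C \<union> ?C))) \<le> (1 / 131072) * n"
    using cover_Qf[of v x] y unfolding cover_def by simp
  then have 1: "real (card (?C \<union> ?C)) < (1/2 + 1/4096) * n"
    using gap1 yV D unfolding no_gap_def by blast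
  have "real (card V) \<le> real (card ?C) + real (card (nbs r ?Q))"
    using fin fin_sub[OF nbs_sub] by (intro card_le_card_add) auto
  with 1 show ?thesis unfolding R_def by (simp add: algebra_simps)
qed

text \<open>The generators of \<open>R v x\<close>, alone or together with \<open>Q\<close>, reach
  \<open>n/2\<close> points up to the first-level error, so \<open>Q\<close> can add little. The
  union has up to twice 131072 vertices, whence the limit 300000 on definability.\<close>

lemma R_robust:
  assumes v: "v \<in> V" and Q: "Q \<subseteq> nb r v" "card Q \<le> 131072"
  shows "real (card (nbs r Q - R v x)) \<le> 4/8192 * n + 1"
proof -
  have "card (Q \<union> Qf v x) \<le> 300000" using Q(2) Qf(2)[of v x] card_Un_le[of Q "Qf v x"] by simp
  moreover have "Q \<union> Qf v x \<subseteq> nb r v" using Q Qf(1)[of v x] by auto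
  ultimately have "real (card (nbs r (Q \<union> Qf v x))) \<le> (1/2 + 1/4096) * n + 1"
    using nbs_upper[OF v] by simp
  moreover have "nbs r (Q \<union> Qf v x) = (nbs r Q - R v x) \<union> R v x"
    unfolding R_def nbs_def by auto
  moreover have "card ((nbs r Q - R v x) \<union> R v x) = card (nbs r Q - R v x) + card (R v x)"
    using fin_R fin_sub[OF nbs_sub] by (intro card_Un_disjoint) auto
  ultimately show ?thesis using R_lower[OF v, of x] by (simp add: algebra_simps)
qed

text \<open>Seen from \<open>x\<close>, the set \<open>R x x\<close> avoids \<open>nb r x\<close>,
  and the complement of \<open>R y x\<close> nearly does, because \<open>nb r x\<close> hardly
  leaves \<open>R y x\<close> by \<open>R_robust\<close>. The second level of \<open>no_gap\<close>
  bounds the union of these two sets, so most of \<open>R y x\<close> lies outside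
  \<open>R x x\<close>.\<close>

lemma R_edge:
  assumes x: "x \<in> V" and xy: "y \<in> nb r x"
  shows "real (card (R x x \<inter> R y y)) \<le> n / 60"
proof -
  have yV: "y \<in> V" and xny: "x \<in> nb r y" using xy nb_sub[of x] nb_sym[of y r x] by auto
  let ?A = "R x x - {x}" and ?B = "V - (R y x - {x})"
  have A: "?A \<in> definable 300000 (del r x) V"
    unfolding R_def using Qf[of x x] by (intro definable_nbs) auto
  have B: "?B \<in> definable 300000 (del r x) V"
    unfolding R_def using Qf[of y x] by (intro definable_nbs_compl) auto
  have "nb r x \<inter> (?A \<union> ?B) \<subseteq> nb r x - R y x"
    using nbs_avoid[of "Qf x x" x] Qf(1)[of x x] tame_irrefl[OF tame, of x] unfolding R_def by blast
  moreover have "nb r x = nbs r {x}" by (simp add: nbs_def)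
  ultimately have "real (card (nb r x \<inter> (?A \<union> ?B))) \<le> real (card (nbs r {x} - R y x))"
    using fin_sub[OF nbs_sub] by (simp add: card_mono)
  also have "\<dots> \<le> 4/8192 * n + 1" using R_robust[OF yV, of "{x}"] xny by simp
  also have "\<dots> \<le> 7/8192 * n" using large by simp
  finally have 1: "real (card (?A \<union> ?B)) < (1/2 + 1/64) * n"
    using gap2 x A B unfolding no_gap_def by blast
  have "real (card V) \<le> real (card (?A \<union> ?B)) + real (card (R y x - R x x))"
    using fin fin_R R_sub[of y x] by (intro card_le_card_add) auto
  then have 2: "real (card (R y x - R x x)) \<ge> (1/2 - 1/64) * n" using 1 by simp
  have "card (R y x) = card (R y x - R x x) + card (R y x \<inter> R x x)"
    using fin_R by (metis add.commute card_Int_Diff)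
  then have 3: "real (card (R y x \<inter> R x x)) \<le> (1/64 + 1/4096) * n + 1"
    using 2 R_upper[OF yV, of x] by (simp add: algebra_simps)
  have 4: "real (card (R y y - R y x)) \<le> 4/8192 * n + 1"
    using R_robust[OF yV, of "Qf y y" x] Qf[of y y] unfolding R_def by auto
  have "real (card (R x x \<inter> R y y)) \<le> real (card (R y x \<inter> R x x)) + real (card (R y y - R y x))"
    using fin_R by (intro card_le_card_add) auto
  with 3 4 large show ?thesis by simp
qed

text \<open>The overlap of \<open>R z z\<close> with one fixed set \<open>A\<close> acts as a
  colouring: the sets at the ends of an edge are nearly complementary, so their overlaps add up to
  about \<open>n/2\<close>, while each single overlap turns out to be near \<open>n/2\<close> or
  near 0.\<close>

lemma bipartite: "\<exists>X\<subseteq>V. \<forall>(u, v)\<in>r. (u \<in> X) \<noteq> (v \<in> X)"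
proof -
  have "V \<noteq> {}" using large by auto
  then obtain x0 where x0: "x0 \<in> V" by blast
  have ex_nb: "\<exists>y. y \<in> nb r v" if "v \<in> V" for v
    using mindeg[OF that] large by (metis card.empty all_not_in_conv divide_le_0_iff less_le_trans not_le of_nat_0 zero_less_numeral zero_less_power)
  obtain y0 where y0: "y0 \<in> nb r x0" using ex_nb[OF x0] by blast
  have y0V: "y0 \<in> V" using y0 nb_sub[of x0] by auto
  define A where "A = R x0 x0"
  define s where "s z = real (card (R z z \<inter> A))" for z
  have A: "(1/2 - 1/4096) * n \<le> real (card A)" "real (card A) \<le> (1/2 + 1/4096) * n + 1"
    unfolding A_def using R_lower[OF x0] R_upper[OF x0] by blast+
  have edge: "0.48 * n \<le> s u + s v \<and> s u + s v \<le> 0.52 * n" if v: "v \<in> V" and uv: "u \<in> nb r v" for u v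
  proof -
    have u: "u \<in> V" using uv nb_sub[of v] by auto
    let ?U = "R u u" and ?W = "R v v"
    have I: "real (card (?W \<inter> ?U)) \<le> n / 60" using R_edge[OF v uv] .
    have finA: "finite A" unfolding A_def by (rule fin_R)
    have "card (?U \<inter> A) + card (?W \<inter> A) = card ((?U \<inter> A) \<union> (?W \<inter> A)) + card ((?U \<inter> A) \<inter> (?W \<inter> A))"
      using fin_R by (intro card_Un_Int) auto
    moreover have "card ((?U \<inter> A) \<union> (?W \<inter> A)) \<le> card A" using finA by (intro card_mono) auto
    moreover have "card ((?U \<inter> A) \<inter> (?W \<inter> A)) \<le> card (?W \<inter> ?U)" using fin_R by (intro card_mono) auto
    ultimately have up: "s u + s v \<le> real (card A) + real (card (?W \<inter> ?U))" unfolding s_def by linarith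
    have un: "card ?U + card ?W = card (?U \<union> ?W) + card (?U \<inter> ?W)"
      using fin_R by (intro card_Un_Int) auto
    have un2: "card (V - (?U \<union> ?W)) = card V - card (?U \<union> ?W)" "card (?U \<union> ?W) \<le> card V"
      using fin_R R_sub[of u u] R_sub[of v v] fin by (auto intro!: card_Diff_subset card_mono)
    have "real (card A) \<le> real (card ((?U \<inter> A) \<union> (?W \<inter> A))) + real (card (V - (?U \<union> ?W)))"
      using finA fin R_sub[of x0 x0] unfolding A_def by (intro card_le_card_add) auto
    moreover have "real (card ((?U \<inter> A) \<union> (?W \<inter> A))) \<le> s u + s v"
      unfolding s_def using card_Un_le[of "?U \<inter> A" "?W \<inter> A"] by linarith
    ultimately have lo: "real (card A) \<le> s u + s v + (n - real (card (?U \<union> ?W)))"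
      using un2 by (simp add: of_nat_diff)
    have "real (card (?U \<union> ?W)) \<ge> 2 * (1/2 - 1/4096) * n - n / 60"
      using un I R_lower[OF u, of u] R_lower[OF v, of v] by (simp add: Int_commute)
    then show ?thesis using up lo I A large by simp
  qed
  have s0: "s x0 \<ge> (1/2 - 1/4096) * n" unfolding s_def A_def[symmetric] using A(1) by simp
  have sy0: "s y0 \<le> 0.021 * n" using edge[OF x0 y0] s0 large by simp
  \<comment> \<open>Vertices with a common neighbour have nearly the same \<open>s\<close>, by
    \<open>edge\<close> applied twice; points of \<open>R v v\<close> have a common neighbour with
    \<open>v\<close>.\<close>
  have two: "\<exists>q\<in>V. q \<in> nb r v \<and> q \<in> nb r z" if z: "z \<in> R v v" for z v
  proof -
    obtain q where q: "q \<in> Qf v v" "z \<in> nb r q" using z unfolding R_def nbs_def by auto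
    then show ?thesis using Qf(1,3)[of v v] nb_sym[of z r q] by auto
  qed
  have zA: "s z \<ge> 0.45 * n" if z: "z \<in> A" for z
  proof -
    obtain q where q: "q \<in> V" "q \<in> nb r x0" "q \<in> nb r z" using two[of z x0] z unfolding A_def by auto
    have zV: "z \<in> V" using z R_sub[of x0 x0] unfolding A_def by auto
    show ?thesis using edge[OF x0 q(2)] edge[OF zV q(3)] s0 large by simp
  qed
  have zB: "s z \<le> 0.07 * n" if z: "z \<in> R y0 y0" for z
  proof -
    obtain q where q: "q \<in> V" "q \<in> nb r y0" "q \<in> nb r z" using two[of z y0] z by auto
    have zV: "z \<in> V" using z R_sub[of y0 y0] by auto
    show ?thesis using edge[OF y0V q(2)] edge[OF zV q(3)] sy0 large by simp
  qed
  \<comment> \<open>\<open>A\<close> and \<open>R y0 y0\<close> together miss fewer than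
    \<open>n / 32\<close> vertices, which is the minimal degree. So a vertex outside both still has
    a neighbour whose \<open>s\<close> is already known to be extreme.\<close>
  have dich: "s z \<ge> 0.4 * n \<or> s z \<le> 0.1 * n" if z: "z \<in> V" for z
  proof (cases "z \<in> A \<union> R y0 y0")
    case True
    then show ?thesis using zA zB large by force
  next
    case False
    let ?U = "A \<union> R y0 y0"
    have U: "card ?U \<le> card V" "card (V - ?U) = card V - card ?U"
      using fin_R R_sub[of x0 x0] R_sub[of y0 y0] fin unfolding A_def
      by (auto intro!: card_Diff_subset card_mono)
    have "card A + card (R y0 y0) = card ?U + card (A \<inter> R y0 y0)"
      unfolding A_def using fin_R by (intro card_Un_Int) auto
    then have "real (card ?U) \<ge> 2 * (1/2 - 1/4096) * n - n / 60"
      using R_edge[OF x0 y0] A(1) R_lower[OF y0V, of y0] unfolding A_def by simp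
    then have "real (card (V - ?U)) < n / 32" using U large by (simp add: of_nat_diff)
    then have "real (card (V - ?U)) < real (card (nb r z))" using mindeg[OF z] by linarith
    then have "\<not> nb r z \<subseteq> V - ?U" using fin card_mono[of "V - ?U" "nb r z"] by auto
    then obtain q where q: "q \<in> nb r z" "q \<in> ?U" using nb_sub[of z] by auto
    have "s q \<ge> 0.45 * n \<or> s q \<le> 0.07 * n" using q zA zB by blast
    then show ?thesis using edge[OF z q(1)] by auto
  qed
  let ?X = "{z \<in> V. s z \<ge> 0.4 * n}"
  have "(u \<in> ?X) \<noteq> (v \<in> ?X)" if uv: "(u, v) \<in> r" for u v
  proof -
    have V: "u \<in> V" "v \<in> V" using uv sub by auto
    have nb: "u \<in> nb r v" using uv by (simp add: mem_nb)
    have "n > 0" using large by simp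
    then show ?thesis
      using edge[OF V(2) nb] dich[OF V(1)] dich[OF V(2)] V by auto
  qed
  then show ?thesis by (intro exI[of _ ?X]) auto
qed

end

section \<open>Directed paths with three edges in the bipartite case\<close>

locale robust_bip = robust +
  fixes X :: "'a set"
  assumes X: "X \<subseteq> V" and bip: "(u, v) \<in> r \<Longrightarrow> (u \<in> X) \<noteq> (v \<in> X)"
begin

lemma converse_bip: "robust_bip V (r\<inverse>) X"
proof -
  interpret c: robust V "r\<inverse>" by (rule converse)
  show ?thesis using X bip by unfold_locales auto
qed

lemma nb_side: "u \<in> nb r v \<Longrightarrow> (u \<in> X) \<noteq> (v \<in> X)"
  using bip[of u v] bip[of v u] by (auto simp: mem_nb)

lemma R_side:
  assumes z: "z \<in> R v v" shows "(z \<in> X) = (v \<in> X)"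
proof -
  obtain q where q: "q \<in> Qf v v" "z \<in> nb r q" using z unfolding R_def nbs_def by auto
  then have "q \<in> nb r v" using Qf(1)[of v v] by auto
  then show ?thesis using nb_side[of q v] nb_side[OF q(2)] by auto
qed

lemma opposite_union:
  assumes w: "w \<in> V" and Z: "Z \<subseteq> V" "\<And>z. z \<in> Z \<Longrightarrow> (z \<in> X) \<noteq> (w \<in> X)"
  shows "nb r w \<inter> ((R w w - {w}) \<union> Z) = nb r w \<inter> Z"
    "real (card ((R w w - {w}) \<union> Z)) \<ge> (1/2 - 1/4096) * n - 1 + real (card Z)"
proof -
  have "nb r w \<inter> R w w = {}"
    unfolding R_def using Qf(1)[of w w] by (intro nbs_avoid) auto
  then show "nb r w \<inter> ((R w w - {w}) \<union> Z) = nb r w \<inter> Z" by auto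
  have "(R w w - {w}) \<inter> Z = {}" using R_side[of _ w] Z(2) by auto
  then have "card ((R w w - {w}) \<union> Z) = card (R w w - {w}) + card Z"
    using fin_R fin_sub[OF Z(1)] by (intro card_Un_disjoint) auto
  moreover have "real (card (R w w)) \<le> real (card (R w w - {w})) + real (card {w})"
    using fin_R by (intro card_le_card_add) auto
  ultimately show "real (card ((R w w - {w}) \<union> Z)) \<ge> (1/2 - 1/4096) * n - 1 + real (card Z)"
    using R_lower[OF w, of w] by simp
qed

lemma R_definable: "R w w - {w} \<in> definable 300000 (del r w) V"
  unfolding R_def using Qf[of w w] by (intro definable_nbs) auto

text \<open>\<open>R w w\<close> avoids \<open>nb r w\<close> and already takes about half of
  \<open>V\<close>, all on the side of \<open>w\<close>. A set on the other side that also avoids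
  \<open>nb r w\<close> must fit into the slack that \<open>no_gap\<close> leaves.\<close>

lemma opposite_disjoint_small:
  assumes w: "w \<in> V" and Z: "Z \<subseteq> V" "\<And>z. z \<in> Z \<Longrightarrow> (z \<in> X) \<noteq> (w \<in> X)"
    and D: "Z \<in> definable 300000 (del r w) V" and dis: "nb r w \<inter> Z = {}"
  shows "real (card Z) \<le> 7/8192 * n"
proof -
  have "real (card ((R w w - {w}) \<union> Z)) < (1/2 + 1/4096) * n"
    using opposite_union(1)[OF w Z] dis by (intro no_gapD[OF gap1 w R_definable D]) simp
  then show ?thesis using opposite_union(2)[OF w Z] large by simp
qed

text \<open>The same argument with exceptions, hence at the second level; the slack is
  \<open>n/64\<close> plus lower errors, rounded up to \<open>n/60\<close>.\<close>

lemma opposite_sparse_small: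
  assumes w: "w \<in> V" and Z: "Z \<subseteq> V" "\<And>z. z \<in> Z \<Longrightarrow> (z \<in> X) \<noteq> (w \<in> X)"
    and D: "Z \<in> definable 300000 (del r w) V" and sparse: "real (card (nb r w \<inter> Z)) \<le> 7/8192 * n"
  shows "real (card Z) \<le> n / 60"
proof -
  have "real (card ((R w w - {w}) \<union> Z)) < (1/2 + 1/64) * n"
    using opposite_union(1)[OF w Z] sparse by (intro no_gapD[OF gap2 w R_definable D]) simp
  then show ?thesis using opposite_union(2)[OF w Z] large by simp
qed

lemma out_sub: "r `` A \<subseteq> V" and in_sub: "r\<inverse> `` A \<subseteq> V"
  using sub by auto

lemma card_nb: "v \<in> V \<Longrightarrow> real (card (r `` {v})) + real (card (r\<inverse> `` {v})) \<ge> n / 32"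
  using mindeg[of v] card_le_card_add[of "r `` {v}" "r\<inverse> `` {v}" "nb r v"]
    fin_sub[OF out_sub] fin_sub[OF in_sub] by (force simp: nb_def)

text \<open>The out-neighbours of \<open>c\<close> are ends of three-edge paths from
  \<open>a\<close>. Hence they are not adjacent to \<open>a\<close>, although they lie on the other
  side of the bipartition.\<close>

lemma path_out_small:
  assumes p: "(a, b) \<in> r" "(b, c) \<in> r" "(c, d) \<in> r"
  shows "real (card (r `` {c})) \<le> 7/8192 * n"
proof (rule opposite_disjoint_small)
  show aV: "a \<in> V" using p sub by auto
  show "r `` {c} \<subseteq> V" by (rule out_sub)
  show "(z \<in> X) \<noteq> (a \<in> X)" if "z \<in> r `` {c}" for z
    using that bip[OF p(1)] bip[OF p(2)] bip[of c z] by auto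
  have "c \<noteq> a" using p(1,2) tame_asym[OF tame] by metis
  moreover have "(c, a) \<notin> r" using bip[OF p(1)] bip[OF p(2)] bip[of c a] by auto
  ultimately show "r `` {c} \<in> definable 300000 (del r a) V"
    using p sub by (intro definable_out) auto
  show "nb r a \<inter> r `` {c} = {}"
    using tame_path[OF tame p(1,2)] by auto
qed

lemma path_in_small:
  assumes p: "(a, b) \<in> r" "(b, c) \<in> r" "(c, d) \<in> r"
  shows "real (card (r\<inverse> `` {b})) \<le> 7/8192 * n"
proof -
  interpret c: robust_bip V "r\<inverse>" X by (rule converse_bip)
  show ?thesis using c.path_out_small[of d c b a] p by simp
qed

lemma path_in2_small:
  assumes p: "(a, b) \<in> r" "(b, c) \<in> r" "(c, d) \<in> r"
  shows "real (card (r\<inverse> `` (r\<inverse> `` {c}))) \<le> 7/8192 * n"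
proof (rule opposite_disjoint_small)
  show "d \<in> V" using p sub by auto
  show "r\<inverse> `` (r\<inverse> `` {c}) \<subseteq> V" by (rule in_sub)
  show side: "(z \<in> X) \<noteq> (d \<in> X)" if "z \<in> r\<inverse> `` (r\<inverse> `` {c})" for z
    using that bip[OF p(3)] bip[of _ c] bip[of z] by auto
  have "c \<noteq> d" "d \<notin> r\<inverse> `` {c}" using p(3) tame_asym[OF tame] by auto
  moreover have "d \<notin> r\<inverse> `` (r\<inverse> `` {c})" using side[of d] by auto
  ultimately show "r\<inverse> `` (r\<inverse> `` {c}) \<in> definable 300000 (del r d) V"
    using p sub by (intro definable_in2) auto
  have "z \<notin> nb r d" if z: "z \<in> r\<inverse> `` (r\<inverse> `` {c})" for z
  proof -
    obtain y where "(z, y) \<in> r" "(y, c) \<in> r" using z by auto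
    then have "d \<notin> nb r z" using tame_path[OF tame _ _ p(3)] by auto
    then show ?thesis using nb_sym by metis
  qed
  then show "nb r d \<inter> r\<inverse> `` (r\<inverse> `` {c}) = {}" by auto
qed

text \<open>An edge into \<open>a\<close> would make \<open>b\<close> the third vertex of one
  three-edge path and the second of another. Then its out- and in-neighbourhoods are both small,
  against the minimal degree.\<close>

lemma path_source:
  assumes p: "(a, b) \<in> r" "(b, c) \<in> r" "(c, d) \<in> r"
  shows "(u, a) \<notin> r"
proof
  assume u: "(u, a) \<in> r"
  have "real (card (r `` {b})) \<le> 7/8192 * n" using path_out_small[OF u p(1,2)] .
  moreover have "b \<in> V" using p sub by auto
  ultimately show False using path_in_small[OF p] card_nb[of b] large by simp
qed

text \<open>The out-neighbourhood of \<open>c\<close> is small, so its in-neighbourhood is large. By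
  the choice of \<open>x\<close> no edge leads from \<open>x\<close> into that set, so
  \<open>x\<close> meets it only in in-neighbours of its own; if these were few,
  \<open>opposite_sparse_small\<close> would make the set small.\<close>

lemma path_many_in:
  assumes p: "(a, b) \<in> r" "(b, c) \<in> r" "(c, d) \<in> r"
    and x: "x \<in> V" "(x \<in> X) = (c \<in> X)" "x \<notin> r\<inverse> `` (r\<inverse> `` {c})"
  shows "real (card (r\<inverse> `` {x})) > 7/8192 * n"
proof (rule ccontr)
  assume neg: "\<not> real (card (r\<inverse> `` {x})) > 7/8192 * n"
  have cV: "c \<in> V" using p sub by auto
  have big: "real (card (r\<inverse> `` {c})) \<ge> n / 32 - 7/8192 * n"
    using path_out_small[OF p] card_nb[OF cV] by simp
  have "real (card (r\<inverse> `` {c})) \<le> n / 60"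
  proof (rule opposite_sparse_small)
    show "x \<in> V" by fact
    show "r\<inverse> `` {c} \<subseteq> V" by (rule in_sub)
    show side: "(z \<in> X) \<noteq> (x \<in> X)" if "z \<in> r\<inverse> `` {c}" for z
      using that x(2) bip[of z c] by auto
    have "c \<noteq> x" using neg big large by auto
    moreover have "(x, c) \<notin> r" using side[of x] by auto
    ultimately have "r\<inverse> `` {c} \<in> definable 300000 (del (r\<inverse>) x) V"
      using cV by (intro definable_out) auto
    then show "r\<inverse> `` {c} \<in> definable 300000 (del r x) V"
      unfolding del_converse definable_converse .
    have "nb r x \<inter> r\<inverse> `` {c} \<subseteq> r\<inverse> `` {x}" using x(3) by (auto simp: mem_nb)
    then have "card (nb r x \<inter> r\<inverse> `` {c}) \<le> card (r\<inverse> `` {x})"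
      using fin_sub[OF in_sub] by (intro card_mono)
    then show "real (card (nb r x \<inter> r\<inverse> `` {c})) \<le> 7/8192 * n" using neg by simp
  qed
  then show False using big large by simp
qed

text \<open>An edge from \<open>x\<close> in \<open>X\<close> to \<open>y\<close> that avoids both
  exceptional sets would be the middle of a three-edge path, because \<open>x\<close> has many
  in-neighbours and \<open>y\<close> many out-neighbours; but \<open>path_in_small\<close> gives the
  second vertex of such a path few in-neighbours. An edge into \<open>X\<close> that ends in
  \<open>M\<close> or starts in \<open>M'\<close> would yield a directed path with four edges,
  contrary to \<open>path_source\<close> or its converse.\<close>

lemma path_structure_aux:
  assumes p: "(a, b) \<in> r" "(b, c) \<in> r" "(c, d) \<in> r" and cX: "c \<in> X"
  defines "M \<equiv> r\<inverse> `` (r\<inverse> `` {c})" and "M' \<equiv> r `` (r `` {b})"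
  shows "M \<subseteq> V" "M' \<subseteq> V" "real (card M) \<le> 7/8192 * n" "real (card M') \<le> 7/8192 * n"
    "(x, y) \<in> r \<Longrightarrow> x \<in> X \<Longrightarrow> x \<in> M \<or> y \<in> M'"
    "(y, x) \<in> r \<Longrightarrow> x \<in> X \<Longrightarrow> x \<notin> M \<and> y \<notin> M'"
proof -
  interpret c: robust_bip V "r\<inverse>" X by (rule converse_bip)
  show "M \<subseteq> V" "M' \<subseteq> V" unfolding M_def M'_def by (rule in_sub out_sub)+
  show "real (card M) \<le> 7/8192 * n" unfolding M_def by (rule path_in2_small[OF p])
  show "real (card M') \<le> 7/8192 * n"
    unfolding M'_def using c.path_in2_small[of d c b a] p by simp
  show "x \<in> M \<or> y \<in> M'" if xy: "(x, y) \<in> r" "x \<in> X" for x y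
  proof (rule ccontr)
    assume neg: "\<not> (x \<in> M \<or> y \<in> M')"
    have V: "x \<in> V" "y \<in> V" using xy sub by auto
    have 1: "real (card (r\<inverse> `` {x})) > 7/8192 * n"
      using path_many_in[OF p V(1)] neg xy(2) cX unfolding M_def by simp
    have "real (card (r `` {y})) > 7/8192 * n"
      using c.path_many_in[of d c b a y] p V neg bip[OF xy(1)] bip[OF p(2)] xy(2) cX unfolding M'_def by simp
    then have "card (r `` {y}) \<noteq> 0" "card (r\<inverse> `` {x}) \<noteq> 0" using 1 large by auto
    then obtain b1 x2 where "(b1, x) \<in> r" "(y, x2) \<in> r" by (metis Image_singleton_iff card.empty converse_iff ex_in_conv)
    then have "real (card (r\<inverse> `` {x})) \<le> 7/8192 * n" using path_in_small xy(1) by metis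
    then show False using 1 by simp
  qed
  show "x \<notin> M \<and> y \<notin> M'" if yx: "(y, x) \<in> r" "x \<in> X" for x y
  proof
    show "x \<notin> M"
    proof
      assume "x \<in> M"
      then obtain b' where "(x, b') \<in> r" "(b', c) \<in> r" unfolding M_def by auto
      then show False using path_source[OF _ _ p(3)] yx(1) by metis
    qed
    show "y \<notin> M'"
    proof
      assume "y \<in> M'"
      then obtain c' where "(b, c') \<in> r" "(c', y) \<in> r" unfolding M'_def by auto
      then show False using c.path_source[of y c' b a x] p(1) yx(1) by auto
    qed
  qed
qed

text \<open>Otherwise \<open>s\<close> has no neighbour among the in-neighbours \<open>z\<close> of
  \<open>y\<close>: an edge from \<open>s\<close> to \<open>z\<close> gives the path
  \<open>s\<close>, \<open>z\<close>, \<open>y\<close>, \<open>t'\<close>, and one from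
  \<open>z\<close> to \<open>s\<close> gives \<open>z\<close>, \<open>s\<close>, \<open>x\<close>,
  \<open>t\<close>. So \<open>y\<close> has few in-neighbours, and by the converse argument few
  out-neighbours.\<close>

lemma mids_one_side:
  assumes nop: "\<And>a b c d. (a, b) \<in> r \<Longrightarrow> (b, c) \<in> r \<Longrightarrow> (c, d) \<notin> r"
    and x: "(s, x) \<in> r" "(x, t) \<in> r" and y: "(s', y) \<in> r" "(y, t') \<in> r"
  shows "(x \<in> X) = (y \<in> X)"
proof (rule ccontr)
  assume ne: "(x \<in> X) \<noteq> (y \<in> X)"
  have key: "real (card (r\<inverse> `` {y})) \<le> 7/8192 * n"
    if nop: "\<And>a b c d. (a, b) \<in> r \<Longrightarrow> (b, c) \<in> r \<Longrightarrow> (c, d) \<notin> r"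
    and x: "(s, x) \<in> r" "(x, t) \<in> r" and y: "(s', y) \<in> r" "(y, t') \<in> r"
    and rb: "robust_bip V r X" for r s t s' t'
  proof -
    interpret q: robust_bip V r X by fact
    show ?thesis
    proof (rule q.opposite_disjoint_small)
      show "s \<in> V" using x q.sub by auto
      show "r\<inverse> `` {y} \<subseteq> V" by (rule q.in_sub)
      show "(z \<in> X) \<noteq> (s \<in> X)" if "z \<in> r\<inverse> `` {y}" for z
        using that ne q.bip[of z y] q.bip[OF x(1)] by auto
      have ysr: "(s, y) \<notin> r" using ne q.bip[OF x(1)] q.bip[of s y] by auto
      have "y \<noteq> s" using y(1) x nop by metis
      then have "r\<inverse> `` {y} \<in> definable 300000 (del (r\<inverse>) s) V"
        using ysr y q.sub by (intro definable_out) auto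
      then show "r\<inverse> `` {y} \<in> definable 300000 (del r s) V"
        unfolding del_converse definable_converse .
      have "(s, z) \<notin> r \<and> (z, s) \<notin> r" if "(z, y) \<in> r" for z
        using nop that x y by metis
      then show "nb r s \<inter> r\<inverse> `` {y} = {}" by (auto simp: mem_nb)
    qed
  qed
  have "real (card (r\<inverse> `` {y})) \<le> 7/8192 * n"
    by (rule key[OF _ x y robust_bip_axioms]) (rule nop)
  moreover have "real (card ((r\<inverse>)\<inverse> `` {y})) \<le> 7/8192 * n"
  proof (rule key[of "r\<inverse>" t s t' s'])
    show "(c, d) \<notin> r\<inverse>" if "(a, b) \<in> r\<inverse>" "(b, c) \<in> r\<inverse>" for a b c d
      using nop[of d c b a] that by auto
  qed (use x y converse_bip in simp_all)
  moreover have "y \<in> V" using y sub by auto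
  ultimately show False using card_nb[of y] large by simp
qed

end

text \<open>Given \<open>X\<close>, \<open>M\<close> and \<open>M'\<close>, every orientation is
  forced: an edge leaves \<open>X\<close> exactly if its end in \<open>X\<close> lies in
  \<open>M\<close> or its other end in \<open>M'\<close>. Only the underlying bipartite graph
  remains to be counted.\<close>

definition two_layerish :: "real \<Rightarrow> 'a set \<Rightarrow> 'a rel \<Rightarrow> bool" where
  "two_layerish g V r \<longleftrightarrow> r \<subseteq> V \<times> V \<and> (\<exists>X M M'. X \<subseteq> V \<and> M \<subseteq> V \<and> M' \<subseteq> V
     \<and> real (card M) \<le> g * card V \<and> real (card M') \<le> g * card V
     \<and> (\<forall>(u, v)\<in>r. (u \<in> X) \<noteq> (v \<in> X))
     \<and> (\<forall>(u, v)\<in>r. u \<in> X \<longrightarrow> u \<in> M \<or> v \<in> M')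
     \<and> (\<forall>(u, v)\<in>r. v \<in> X \<longrightarrow> v \<notin> M \<and> u \<notin> M'))"

definition three_layered :: "'a set \<Rightarrow> 'a rel \<Rightarrow> bool" where
  "three_layered V r \<longleftrightarrow> (\<exists>X S. X \<subseteq> V \<and> S \<subseteq> V - X \<and> r \<subseteq> S \<times> X \<union> X \<times> (V - X - S))"

lemma (in robust_bip) two_layerish_of_path:
  assumes p: "(a, b) \<in> r" "(b, c) \<in> r" "(c, d) \<in> r" and cX: "c \<in> X"
  shows "two_layerish (7/8192) V r"
proof -
  note q = path_structure_aux[OF p cX]
  have 1: "\<forall>(u, v)\<in>r. (u \<in> X) \<noteq> (v \<in> X)" 
    using bip by (intro ballI) (simp only: split_paired_all prod.case, metis)
  have 2: "\<forall>(u, v)\<in>r. u \<in> X \<longrightarrow> u \<in> r\<inverse> `` (r\<inverse> `` {c}) \<or> v \<in> r `` (r `` {b})"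
    using q(5) by (intro ballI) (simp only: split_paired_all prod.case, iprover)
  have 3: "\<forall>(u, v)\<in>r. v \<in> X \<longrightarrow> v \<notin> r\<inverse> `` (r\<inverse> `` {c}) \<and> u \<notin> r `` (r `` {b})"
    using q(6) by (intro ballI) (simp only: split_paired_all prod.case, iprover)
  show ?thesis
    unfolding two_layerish_def
    by (rule conjI[OF sub], rule exI[of _ X], rule exI[of _ "r\<inverse> `` (r\<inverse> `` {c})"],
        rule exI[of _ "r `` (r `` {b})"]) (intro conjI X q(1-4) 1 2 3)
qed

lemma (in robust_bip) robust_bip_compl: "robust_bip V r (V - X)"
proof unfold_locales
  show "(u \<in> V - X) \<noteq> (v \<in> V - X)" if "(u, v) \<in> r" for u v
    using bip[OF that] that sub by auto
qed auto

lemma (in robust_bip) three_layered_of_mids: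
  assumes mid: "\<And>x s t. (s, x) \<in> r \<Longrightarrow> (x, t) \<in> r \<Longrightarrow> x \<in> X"
  shows "three_layered V r"
proof -
  define S where "S = Domain r - X"
  have "(u, v) \<in> S \<times> X \<union> X \<times> (V - X - S)" if uv: "(u, v) \<in> r" for u v
  proof (cases "u \<in> X")
    case True
    then have "v \<in> V - X" using bip[OF uv] uv sub by auto
    moreover have "v \<notin> S" using mid[OF uv] calculation unfolding S_def by auto
    ultimately show ?thesis using True by auto
  next
    case False
    then show ?thesis using bip[OF uv] uv unfolding S_def by auto
  qed
  then have "r \<subseteq> S \<times> X \<union> X \<times> (V - X - S)" by auto
  moreover have "S \<subseteq> V - X" using sub unfolding S_def by auto
  ultimately show ?thesis unfolding three_layered_def using X by metis
qed

lemma (in robust) layered: "two_layerish (7/8192) V r \<or> three_layered V r"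
proof -
  obtain X where X: "X \<subseteq> V" "\<forall>(u, v)\<in>r. (u \<in> X) \<noteq> (v \<in> X)"
    using bipartite by metis
  interpret robust_bip V r X using X by unfold_locales auto
  interpret co: robust_bip V r "V - X" by (rule robust_bip_compl)
  show ?thesis
  proof (cases "\<exists>a b c d. (a, b) \<in> r \<and> (b, c) \<in> r \<and> (c, d) \<in> r")
    case True
    then obtain a b c d where p: "(a, b) \<in> r" "(b, c) \<in> r" "(c, d) \<in> r" by metis
    have "c \<in> X \<or> c \<in> V - X" using p sub by auto
    then show ?thesis using two_layerish_of_path[OF p] co.two_layerish_of_path[OF p] by metis
  next
    case False
    then have nop: "(c, d) \<notin> r" if "(a, b) \<in> r" "(b, c) \<in> r" for a b c d
      using that by metis
    have "(\<forall>x s t. (s, x) \<in> r \<longrightarrow> (x, t) \<in> r \<longrightarrow> x \<in> X)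
      \<or> (\<forall>x s t. (s, x) \<in> r \<longrightarrow> (x, t) \<in> r \<longrightarrow> x \<notin> X)"
    proof (rule ccontr)
      assume neg: "\<not> ?thesis"
      then obtain x s t where x: "(s, x) \<in> r" "(x, t) \<in> r" "x \<notin> X" by blast
      obtain y s' t' where y: "(s', y) \<in> r" "(y, t') \<in> r" "y \<in> X" using neg by blast
      show False using mids_one_side[OF nop x(1,2) y(1,2)] x(3) y(3) by simp
    qed
    then show ?thesis
    proof
      assume "\<forall>x s t. (s, x) \<in> r \<longrightarrow> (x, t) \<in> r \<longrightarrow> x \<in> X"
      then show ?thesis using three_layered_of_mids by metis
    next
      assume a: "\<forall>x s t. (s, x) \<in> r \<longrightarrow> (x, t) \<in> r \<longrightarrow> x \<notin> X"
      have "x \<in> V - X" if "(s, x) \<in> r" "(x, t) \<in> r" for x s t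
        using a that sub by auto
      then show ?thesis using co.three_layered_of_mids by metis
    qed
  qed
qed

section \<open>Counting the exceptional digraphs\<close>

text \<open>Relations are pulled back along \<open>g\<close>. Tameness only forbids patterns and so
  survives, and surjectivity of \<open>g\<close> keeps different relations apart.\<close>

lemma card_tames_mono:
  assumes W: "finite W" and g: "g ` W = V"
  shows "card (tames V) \<le> card (tames W)"
proof (rule card_inj_on_le)
  let ?F = "\<lambda>r. {(x, y). x \<in> W \<and> y \<in> W \<and> (g x, g y) \<in> r}"
  show "inj_on ?F (tames V)"
  proof (rule inj_onI)
    fix r s assume rs: "r \<in> tames V" "s \<in> tames V" "?F r = ?F s"
    have "(u, v) \<in> r \<longleftrightarrow> (u, v) \<in> s" for u v
    proof (cases "u \<in> V \<and> v \<in> V")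
      case True
      then obtain x y where "x \<in> W" "y \<in> W" "u = g x" "v = g y" using g by auto
      then show ?thesis using rs(3) by (auto simp: set_eq_iff)
    next
      case False
      then show ?thesis using rs(1,2) by (auto simp: tames_def)
    qed
    then show "r = s" by auto
  qed
  have "tame (?F r)" if r: "tame r" for r
  proof (rule tameI)
    have nb: "y \<in> nb (?F r) x \<Longrightarrow> g y \<in> nb r (g x)" for x y by (auto simp: mem_nb)
    show "(y, x) \<notin> ?F r" if "(x, y) \<in> ?F r" for x y
      using that tame_asym[OF r, of "g x" "g y"] by auto
    show "z \<notin> nb (?F r) x" if "y \<in> nb (?F r) x" "z \<in> nb (?F r) y" for x y z
      using tame_triangle[OF r nb[OF that(1)] nb[OF that(2)]] nb[of z x] by metis
    show "d \<notin> nb (?F r) a" if "(a, b) \<in> ?F r" "(b, c) \<in> ?F r" "(c, d) \<in> ?F r" for a b c d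
      using tame_path[OF r, of "g a" "g b" "g c" "g d"] that nb[of d a] by auto
  qed
  then show "?F ` tames V \<subseteq> tames W" by (auto simp: tames_def)
  show "finite (tames W)" using W by (rule finite_tames)
qed

section \<open>Digraphs encoded by deleting a vertex\<close>

definition tame_count :: "nat \<Rightarrow> nat" where
  "tame_count m = card (tames {0..<m})"

lemma card_tames:
  assumes "finite V" shows "card (tames V) = tame_count (card V)"
proof -
  obtain f where f: "bij_betw f {0..<card V} V" using ex_bij_betw_nat_finite[OF assms] by blast
  have "card (tames V) \<le> tame_count (card V)"
    unfolding tame_count_def using f by (intro card_tames_mono[of _ f]) (auto simp: bij_betw_def)
  moreover have "tame_count (card V) \<le> card (tames V)"
    unfolding tame_count_def using bij_betw_inv_into[OF f] assms
    by (intro card_tames_mono[of _ "inv_into {0..<card V} f"]) (auto simp: bij_betw_def)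
  ultimately show ?thesis by simp
qed

text \<open>A short neighbourhood can be listed together with its orientations:
  \<open>card_small_subsets\<close> with \<open>m = 4\<close> gives the exponent \<open>n/4\<close>
  for the set, the orientations add \<open>n/32\<close>, and 9/32 is below 3/10.\<close>

lemma card_low_degree:
  assumes V: "finite V"
  shows "real (card {r \<in> tames V. \<exists>v\<in>V. real (card (nb r v)) < card V / 32})
    \<le> card V * (tame_count (card V - 1) * (2 powr (3/10 * card V)))"
proof -
  let ?n = "real (card V)"
  let ?small = "{E. E \<subseteq> V \<and> real (card E) \<le> (1/32) * card V}"
  let ?f = "\<lambda>v r' N U. r' \<union> {v} \<times> U \<union> (N - U) \<times> {v}"
  have small: "real (card ?small) \<le> 2 powr (1/4 * ?n)"
    using card_small_subsets[OF V, of "1/32" 4] by simp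
  have finsmall: "finite ?small" using V by (auto intro: finite_subset[of _ "Pow V"])
  have "{r \<in> tames V. \<exists>v\<in>V. real (card (nb r v)) < card V / 32}
    \<subseteq> (\<Union>v\<in>V. \<Union>r'\<in>tames (V - {v}). \<Union>N\<in>?small. ?f v r' N ` Pow N)" (is "_ \<subseteq> ?U")
  proof
    fix r assume "r \<in> {r \<in> tames V. \<exists>v\<in>V. real (card (nb r v)) < card V / 32}"
    then obtain v where r: "r \<in> tames V" and v: "v \<in> V" "real (card (nb r v)) < card V / 32" by auto
    have t: "tame r" "r \<subseteq> V \<times> V" using r by (auto simp: tames_def)
    have "r = ?f v (del r v) (nb r v) (r `` {v})"
      using tame_asym[OF t(1)] by (auto simp: mem_del mem_nb)
    moreover have "r `` {v} \<in> Pow (nb r v)" by (auto simp: nb_def)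
    moreover have "nb r v \<in> ?small" using v nb_subset[OF t(2)] by auto
    ultimately show "r \<in> ?U" using v del_tames[OF r] by blast
  qed
  then have "real (card {r \<in> tames V. \<exists>v\<in>V. real (card (nb r v)) < card V / 32}) \<le> real (card ?U)"
    using V finsmall finite_tames[of "V - {_}"]
    by (intro of_nat_mono card_mono finite_UN_I finite_imageI) (auto dest: finite_subset)
  also have "\<dots> \<le> ?n * (tame_count (card V - 1) * (2 powr (1/4 * ?n) * 2 powr (1/32 * ?n)))"
  proof (intro card_UN_bound)
    show "real (card (tames (V - {v}))) \<le> real (tame_count (card V - 1))" if "v \<in> V" for v
      using card_tames[of "V - {v}"] V that by simp
    show "real (card (?f v r' N ` Pow N)) \<le> 2 powr (1/32 * ?n)" if N: "N \<in> ?small" for v r' N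
    proof -
      have finN: "finite N" using N V finite_subset by auto
      have "real (card (?f v r' N ` Pow N)) \<le> real (card (Pow N))"
        using finN by (intro of_nat_mono card_image_le) auto
      also have "\<dots> = 2 powr card N" using finN by (simp add: card_Pow powr_realpow)
      also have "\<dots> \<le> 2 powr (1/32 * ?n)" using N by (intro powr_mono) auto
      finally show ?thesis .
    qed
  qed (use V finsmall small finite_tames in auto)
  also have "2 powr (1/4 * ?n) * 2 powr (1/32 * ?n) \<le> 2 powr (3/10 * ?n)"
    unfolding powr_add[symmetric] by (intro powr_mono) auto
  finally show ?thesis by (simp add: mult_left_mono)
qed

lemma finite_definable: "finite V \<Longrightarrow> finite (definable k r V)"
  unfolding definable_def by (intro finite_UN_I) (auto intro: finite_subset[of _ "Pow V"])

lemma card_definable: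
  assumes "finite V" shows "real (card (definable k r V)) \<le> real (card V + 1) ^ k * 6"
  unfolding definable_def
proof (rule card_UN_bound)
  show "finite {Q. Q \<subseteq> V \<and> card Q \<le> k}" using assms by (auto intro: finite_subset[of _ "Pow V"])
  have "real (card {Q. Q \<subseteq> V \<and> card Q \<le> k}) \<le> real ((card V + 1) ^ k)"
    using card_subsets_le_power[OF assms] by (simp only: of_nat_le_iff)
  then show "real (card {Q. Q \<subseteq> V \<and> card Q \<le> k}) \<le> real (card V + 1) ^ k" by simp
  fix Q
  have "card (set [a, b, c, d, e, f]) \<le> 6" for a b c d e f :: "'a set"
    by (rule order.trans[OF card_length]) simp
  then show "real (card {nbs r Q, V - nbs r Q, r `` Q, r\<inverse> `` Q, r `` r `` Q, r\<inverse> `` r\<inverse> `` Q}) \<le> 6"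
    by (metis (no_types) empty_set list.simps(15) of_nat_le_iff of_nat_numeral)
qed simp

lemma definable_subset:
  assumes r: "r \<subseteq> V \<times> V" and A: "A \<in> definable k r V" shows "A \<subseteq> V"
proof -
  obtain Q where "A \<in> {nbs r Q, V - nbs r Q, r `` Q, r\<inverse> `` Q, r `` r `` Q, r\<inverse> `` r\<inverse> `` Q}"
    using A unfolding definable_def by auto
  then show ?thesis using r nbs_subset[OF r, of Q] by auto
qed

lemma card_le_1I: "(\<And>x y. x \<in> A \<Longrightarrow> y \<in> A \<Longrightarrow> x = y) \<Longrightarrow> card A \<le> 1"
  by (cases "finite A") (auto simp: card_le_Suc0_iff_eq)

text \<open>Supplies the last hypothesis of \<open>orientation_unique\<close>. A greedy cover misses
  fewer than \<open>n / 131072\<close> of the at least \<open>n / 32\<close> neighbours of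
  \<open>y\<close>, so a covered one other than \<open>w\<close> remains.\<close>

lemma exists_orienting_cover:
  assumes V: "finite V" "r \<in> tames V" and large: "real (card V) \<ge> 10 ^ 8"
    and deg: "\<And>v. v \<in> V \<Longrightarrow> real (card (nb r v)) \<ge> card V / 32" and w: "w \<in> V"
  obtains Q where "Q \<subseteq> nb r w" "card Q \<le> 131072"
    "\<And>y. y \<in> nb r w \<Longrightarrow> \<exists>x. x \<noteq> w \<and> x \<in> nbs r Q \<and> x \<in> nb r y"
proof -
  have sub: "r \<subseteq> V \<times> V" using V(2) by (simp add: tames_def)
  let ?n = "real (card V)"
  obtain Q where Q: "Q \<subseteq> nb r w" "card Q * (?n / 131072) \<le> card V"
    "\<And>y. y \<in> nb r w \<Longrightarrow> card (nb r y - nbs r Q) < ?n / 131072"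
  proof (rule greedy_cover[OF V(1) sub, of "nb r w" "?n / 131072"])
    show "nb r w \<subseteq> V" by (rule nb_subset[OF sub])
    show "0 < ?n / 131072" using large by simp
  qed (rule that)
  have "real (card Q) \<le> 131072" using Q(2) large by (simp add: field_simps)
  then have cQ: "card Q \<le> 131072" by simp
  have "\<exists>x. x \<noteq> w \<and> x \<in> nbs r Q \<and> x \<in> nb r y" if y: "y \<in> nb r w" for y
  proof (rule ccontr)
    assume neg: "\<not> ?thesis"
    have yV: "y \<in> V" using y nb_subset[OF sub, of w] by auto
    have "finite (nb r y)" using nb_subset[OF sub, of y] V(1) finite_subset by auto
    then have "real (card (nb r y)) \<le> real (card (nb r y - nbs r Q)) + real (card {w})"
      using neg by (intro card_le_card_add) auto
    then show False using Q(3)[OF y] deg[OF yV] large by simp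
  qed
  then show ?thesis using that Q(1) cQ by metis
qed

text \<open>The factors follow the encoding: the vertex \<open>w\<close>, the digraph without
  \<open>w\<close>, the two definable sets, the in- and out-vertices of an orienting cover, the part
  of \<open>nb r w\<close> outside \<open>A \<union> B\<close>, which is arbitrary in a set of at
  most \<open>(1/2 - d) * n\<close> points, and the small part inside. By
  \<open>orientation_unique\<close> these data determine the digraph.\<close>

lemma card_gap:
  assumes V: "finite V" and large: "real (card V) \<ge> 10 ^ 8"
  shows "real (card {r \<in> tames V. (\<forall>v\<in>V. real (card (nb r v)) \<ge> card V / 32) \<and> \<not> no_gap k g d V r})
    \<le> card V * (tame_count (card V - 1) * ((real (card V + 1) ^ k * 6) ^ 2 * ((real (card V + 1) ^ 131072) ^ 2
        * (2 powr ((1/2 - d) * card V) * 2 powr ((m * g + 2 / 2 ^ m) * card V)))))"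
proof -
  let ?n = "real (card V)"
  let ?bad = "{r \<in> tames V. (\<forall>v\<in>V. real (card (nb r v)) \<ge> card V / 32) \<and> \<not> no_gap k g d V r}"
  let ?small = "{E. E \<subseteq> V \<and> real (card E) \<le> g * card V}"
  let ?Q = "{Q. Q \<subseteq> V \<and> card Q \<le> 131072}"
  let ?D = "\<lambda>r'. {(A, B). A \<in> definable k r' V \<and> B \<in> definable k r' V \<and> real (card (A \<union> B)) \<ge> (1/2 + d) * ?n}"
  let ?T = "\<lambda>w r' Qm Qp N. {r \<in> tames V. del r w = r' \<and> Qm \<times> {w} \<subseteq> r \<and> {w} \<times> Qp \<subseteq> r \<and> nb r w = N
     \<and> (\<forall>y\<in>N. \<exists>x. x \<noteq> w \<and> x \<in> nbs r (Qm \<union> Qp) \<and> x \<in> nb r y)}"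
  have finQ: "finite ?Q" and finsmall: "finite ?small" using V by (auto intro: finite_subset[of _ "Pow V"])
  have finD: "finite (?D r')" for r'
    by (rule finite_subset[of _ "definable k r' V \<times> definable k r' V"]) (auto simp: finite_definable V)
  have finT: "finite (?T w r' Qm Qp N)" for w r' Qm Qp N
    using finite_tames[OF V] by simp
  have T: "card (?T w r' Qm Qp N) \<le> 1" for w r' Qm Qp N
  proof (rule card_le_1I)
    fix r s assume "r \<in> ?T w r' Qm Qp N" "s \<in> ?T w r' Qm Qp N"
    then show "r = s"
      by (intro orientation_unique[of r s w Qm Qp]) (auto simp: tames_def)
  qed
  let ?U = "\<Union>w\<in>V. \<Union>r'\<in>tames (V - {w}). \<Union>(A, B)\<in>?D r'. \<Union>(Qm, Qp)\<in>?Q \<times> ?Q.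
    \<Union>F\<in>Pow (V - (A \<union> B)). \<Union>E\<in>?small. ?T w r' Qm Qp (E \<union> F)"
  have "?bad \<subseteq> ?U"
  proof
    fix r assume r: "r \<in> ?bad"
    then have t: "tame r" "r \<subseteq> V \<times> V" "r \<in> tames V" by (auto simp: tames_def)
    obtain w A B where w: "w \<in> V" and AB: "A \<in> definable k (del r w) V" "B \<in> definable k (del r w) V"
      and E: "real (card (nb r w \<inter> (A \<union> B))) \<le> g * ?n" and big: "real (card (A \<union> B)) \<ge> (1/2 + d) * ?n"
      using r unfolding no_gap_def by (auto simp: not_less)
    obtain Q where Q: "Q \<subseteq> nb r w" "card Q \<le> 131072"
      "\<And>y. y \<in> nb r w \<Longrightarrow> \<exists>x. x \<noteq> w \<and> x \<in> nbs r Q \<and> x \<in> nb r y"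
      using exists_orienting_cover[OF V t(3) large _ w] r by auto
    define Qm Qp where "Qm = Q \<inter> r\<inverse> `` {w}" and "Qp = Q \<inter> r `` {w}"
    have QQ: "Q = Qm \<union> Qp" using Q(1) by (auto simp: Qm_def Qp_def mem_nb)
    have nbV: "nb r w \<subseteq> V" using nb_subset[OF t(2)] .
    have finQ': "finite Q" using Q(1) nbV V finite_subset by metis
    have "card Qm \<le> 131072" "card Qp \<le> 131072"
      using Q(2) finQ' card_mono[of Q Qm] card_mono[of Q Qp] by (auto simp: Qm_def Qp_def)
    then have Qmp: "(Qm, Qp) \<in> ?Q \<times> ?Q" using Q(1) nbV QQ by auto
    have D: "(A, B) \<in> ?D (del r w)" using AB big by simp
    have F: "nb r w - (A \<union> B) \<in> Pow (V - (A \<union> B))" using nbV by auto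
    have E: "nb r w \<inter> (A \<union> B) \<in> ?small" using E nbV by auto
    have "r \<in> ?T w (del r w) Qm Qp (nb r w)"
      using t(3) Q(3) unfolding QQ by (auto simp: Qm_def Qp_def)
    moreover have "nb r w = (nb r w \<inter> (A \<union> B)) \<union> (nb r w - (A \<union> B))" by auto
    ultimately have "r \<in> ?T w (del r w) Qm Qp ((nb r w \<inter> (A \<union> B)) \<union> (nb r w - (A \<union> B)))"
      by simp
    then show "r \<in> ?U"
      by (intro UN_I[OF w] UN_I[OF del_tames[OF t(3)]] UN_I[OF D] case_prodI UN_I[OF Qmp] UN_I[OF F] UN_I[OF E]
          | simp only: prod.case)+
  qed
  moreover have "finite ?U"
    by (intro finite_UN_I V finite_tames finD finite_cartesian_product finQ finsmall | simp add: split_beta V finT)+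
  ultimately have "real (card ?bad) \<le> real (card ?U)"
    by (intro of_nat_mono card_mono)
  also have "\<dots> \<le> ?n * (tame_count (card V - 1) * ((real (card V + 1) ^ k * 6) ^ 2 * ((real (card V + 1) ^ 131072) ^ 2
        * (2 powr ((1/2 - d) * ?n) * (2 powr ((m * g + 2 / 2 ^ m) * ?n) * 1)))))"
  proof (intro card_UN_bound)
    show "real (card (tames (V - {w}))) \<le> real (tame_count (card V - 1))" if "w \<in> V" for w
      using card_tames[of "V - {w}"] V that by simp
    show "real (card (?D r')) \<le> (real (card V + 1) ^ k * 6) ^ 2" for r'
    proof -
      have "card (?D r') \<le> card (definable k r' V \<times> definable k r' V)"
        using finite_definable[OF V] by (intro card_mono) auto
      then have "real (card (?D r')) \<le> real (card (definable k r' V)) ^ 2"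
        by (simp add: card_cartesian_product power2_eq_square flip: of_nat_mult)
      also have "\<dots> \<le> (real (card V + 1) ^ k * 6) ^ 2"
        using card_definable[OF V] by (intro power_mono) auto
      finally show ?thesis .
    qed
    show "real (card (case p of (A, B) \<Rightarrow> \<Union>(Qm, Qp)\<in>?Q \<times> ?Q.
        \<Union>F\<in>Pow (V - (A \<union> B)). \<Union>E\<in>?small. ?T w r' Qm Qp (E \<union> F)))
      \<le> (real (card V + 1) ^ 131072) ^ 2
        * (2 powr ((1/2 - d) * ?n) * (2 powr ((m * g + 2 / 2 ^ m) * ?n) * 1))" 
      if r': "r' \<in> tames (V - {w})" and p: "p \<in> ?D r'" for w r' p
    proof -
      obtain A B where AB: "p = (A, B)" by (cases p)
      have big: "real (card (A \<union> B)) \<ge> (1/2 + d) * ?n" using p AB by auto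
      show ?thesis unfolding AB prod.case
      proof (intro card_UN_bound)
        have "real (card ?Q) \<le> real ((card V + 1) ^ 131072)"
          using card_subsets_le_power[OF V] by (simp only: of_nat_le_iff)
        then have "real (card ?Q) ^ 2 \<le> (real (card V + 1) ^ 131072) ^ 2"
          by (intro power_mono) simp_all
        then show "real (card (?Q \<times> ?Q)) \<le> (real (card V + 1) ^ 131072) ^ 2"
          by (simp add: card_cartesian_product power2_eq_square)
        show "real (card (case q of (Qm, Qp) \<Rightarrow> \<Union>F\<in>Pow (V - (A \<union> B)). \<Union>E\<in>?small. ?T w r' Qm Qp (E \<union> F)))
          \<le> 2 powr ((1/2 - d) * ?n) * (2 powr ((m * g + 2 / 2 ^ m) * ?n) * 1)" for q
        proof (cases q)
          case (Pair Qm Qp)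
          show ?thesis unfolding Pair prod.case
          proof (intro card_UN_bound)
            have "r' \<subseteq> V \<times> V" using r' by (auto simp: tames_def)
            then have "A \<subseteq> V" "B \<subseteq> V"
              using p AB definable_subset[of r' V A k] definable_subset[of r' V B k] by auto
            then have "A \<subseteq> V" "B \<subseteq> V" "finite A" "finite B"
              using V finite_subset by auto
            then have "card (V - (A \<union> B)) = card V - card (A \<union> B)" "card (A \<union> B) \<le> card V"
              using V by (auto intro!: card_Diff_subset card_mono)
            then have "real (card (V - (A \<union> B))) \<le> (1/2 - d) * ?n"
              using big by (simp add: of_nat_diff algebra_simps)
            then have "2 powr real (card (V - (A \<union> B))) \<le> 2 powr ((1/2 - d) * ?n)"
              by (intro powr_mono) auto
            then show "real (card (Pow (V - (A \<union> B)))) \<le> 2 powr ((1/2 - d) * ?n)"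
              using V by (simp add: card_Pow powr_realpow)
            show "real (card ?small) \<le> 2 powr ((m * g + 2 / 2 ^ m) * ?n)"
              by (rule card_small_subsets[OF V])
            show "real (card (?T w r' Qm Qp (E \<union> F))) \<le> 1" for E F
              using T[of w r' Qm Qp "E \<union> F"] by (simp only: of_nat_le_1_iff)
          qed (use V finsmall in auto)
        qed
      qed (use finQ in auto)
    qed
  qed (use V finsmall finite_tames finD in auto)
  finally show ?thesis by simp
qed

section \<open>Direct counting of layered digraphs\<close>

lemma two_power_mult_le:
  fixes x n :: nat assumes "x \<le> n"
  shows "(2::real) ^ (x * (n - x)) \<le> 2 powr (real n ^ 2 / 4)"
proof -
  have "real x * (real n - real x) = real n ^ 2 / 4 - (real n / 2 - real x) ^ 2"
    by (simp add: power2_eq_square field_simps)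
  then have "real (x * (n - x)) \<le> real n ^ 2 / 4" using assms by (simp add: of_nat_diff)
  then show ?thesis by (simp add: powr_realpow[symmetric])
qed

lemma card_two_layerish:
  assumes V: "finite V"
  shows "real (card {r. two_layerish g V r})
    \<le> 2 ^ card V * (2 powr ((m * g + 2 / 2 ^ m) * card V) * (2 powr ((m * g + 2 / 2 ^ m) * card V)
        * 2 powr (real (card V) ^ 2 / 4)))"
proof -
  let ?small = "{E. E \<subseteq> V \<and> real (card E) \<le> g * card V}"
  let ?f = "\<lambda>M M' G. {(x, y) \<in> G. x \<in> M \<or> y \<in> M'} \<union> {(y, x). (x, y) \<in> G \<and> \<not> (x \<in> M \<or> y \<in> M')}"
  have finsmall: "finite ?small" using V by (auto intro: finite_subset[of _ "Pow V"])
  let ?U = "\<Union>X\<in>Pow V. \<Union>M\<in>?small. \<Union>M'\<in>?small. ?f M M' ` Pow (X \<times> (V - X))"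
  have "{r. two_layerish g V r} \<subseteq> ?U"
  proof
    fix r assume "r \<in> {r. two_layerish g V r}"
    then obtain X M M' where r: "r \<subseteq> V \<times> V" and X: "X \<subseteq> V" "M \<in> ?small" "M' \<in> ?small"
      and bde: "\<forall>(u, v)\<in>r. (u \<in> X) \<noteq> (v \<in> X)" "\<forall>(u, v)\<in>r. u \<in> X \<longrightarrow> u \<in> M \<or> v \<in> M'"
        "\<forall>(u, v)\<in>r. v \<in> X \<longrightarrow> v \<notin> M \<and> u \<notin> M'"
      unfolding two_layerish_def mem_Collect_eq by (elim conjE exE) (rule that, simp_all)
    have b: "(u \<in> X) \<noteq> (v \<in> X)" and d: "u \<in> X \<Longrightarrow> u \<in> M \<or> v \<in> M'"
      and e: "v \<in> X \<Longrightarrow> v \<notin> M \<and> u \<notin> M'" if "(u, v) \<in> r" for u v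
      using bde[THEN bspec, OF that] by simp_all
    \<comment> \<open>The underlying graph, each edge stored with its end in \<open>X\<close>
      first.\<close>
    define G where "G = {(x, y). x \<in> X \<and> y \<in> nb r x}"
    have G: "(x, y) \<in> G \<longleftrightarrow> x \<in> X \<and> ((x, y) \<in> r \<or> (y, x) \<in> r)" for x y
      by (simp add: G_def mem_nb)
    have "G \<in> Pow (X \<times> (V - X))" using G b r by auto
    moreover have "(u, v) \<in> r \<longleftrightarrow> (u, v) \<in> ?f M M' G" for u v
    proof
      assume uv: "(u, v) \<in> r"
      show "(u, v) \<in> ?f M M' G"
      proof (cases "u \<in> X")
        case True
        then show ?thesis using d[OF uv] uv G[of u v] by simp
      next
        case False
        then have "v \<in> X" using b[OF uv] by simp
        then show ?thesis using e[OF uv] uv G[of v u] by simp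
      qed
    next
      assume "(u, v) \<in> ?f M M' G"
      then consider "(u, v) \<in> G" "u \<in> M \<or> v \<in> M'" | "(v, u) \<in> G" "\<not> (v \<in> M \<or> u \<in> M')" by auto
      then show "(u, v) \<in> r"
        using d[of v u] e[of v u] G[of u v] G[of v u] by cases blast+
    qed
    then have "r = ?f M M' G" by auto
    ultimately have "r \<in> ?f M M' ` Pow (X \<times> (V - X))" by blast
    then show "r \<in> ?U" using X by (intro UN_I[of X] UN_I[of M] UN_I[of M'] PowI)
  qed
  moreover have "finite ?U"
  proof (intro finite_UN_I finite_imageI)
    show "finite (Pow (X \<times> (V - X)))" if "X \<in> Pow V" for X
      using V rev_finite_subset[OF V, of X] that by simp
  qed (use V finsmall in simp_all)
  ultimately have "real (card {r. two_layerish g V r}) \<le> real (card ?U)"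
    by (intro of_nat_mono card_mono)
  also have "\<dots> \<le> 2 ^ card V * (2 powr ((m * g + 2 / 2 ^ m) * card V) * (2 powr ((m * g + 2 / 2 ^ m) * card V)
        * 2 powr (real (card V) ^ 2 / 4)))"
  proof (intro card_UN_bound)
    show "real (card (Pow V)) \<le> 2 ^ card V" using V by (simp add: card_Pow)
    show "real (card (?f M M' ` Pow (X \<times> (V - X)))) \<le> 2 powr (real (card V) ^ 2 / 4)"
      if X: "X \<in> Pow V" for X M M'
    proof -
      have fX: "finite X" "card X \<le> card V" using X V finite_subset by (auto intro: card_mono)
      have "real (card (?f M M' ` Pow (X \<times> (V - X)))) \<le> real (card (Pow (X \<times> (V - X))))"
        using fX V by (intro of_nat_mono card_image_le) auto
      also have "\<dots> = 2 ^ (card X * (card V - card X))"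
        using fX V X by (simp add: card_Pow card_cartesian_product card_Diff_subset)
      finally show ?thesis using two_power_mult_le[OF fX(2)] by linarith
    qed
    show "real (card ?small) \<le> 2 powr ((m * g + 2 / 2 ^ m) * card V)"
      by (rule card_small_subsets[OF V])
    then show "real (card ?small) \<le> 2 powr ((m * g + 2 / 2 ^ m) * card V)" .
  qed (use V finsmall in auto)
  finally show ?thesis .
qed

text \<open>\<open>S\<close> is the lowest layer and \<open>X\<close> the middle one. Requiring a
  lower neighbour for every vertex outside \<open>S\<close> is what makes the layers recoverable
  once the missing pairs from \<open>S\<close> to the highest layer are filled in.\<close>

definition layered_on :: "'a set \<Rightarrow> 'a set \<Rightarrow> 'a set \<Rightarrow> 'a rel set" where
  "layered_on V S X = {r. r \<subseteq> S \<times> X \<union> X \<times> (V - X - S) \<and> (\<forall>v\<in>V - S. r\<inverse> `` {v} \<noteq> {})}"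

text \<open>A vertex of the highest layer has no out-neighbour, so any neighbour it has is a lower
  one. The only way to miss \<open>layered_on\<close> is a middle vertex without lower neighbours,
  which is the second alternative.\<close>

lemma three_layered_cases:
  assumes r: "three_layered V r" and nb: "\<And>v. v \<in> V \<Longrightarrow> nb r v \<noteq> {}" and ne: "V \<noteq> {}"
  shows "(\<exists>S\<in>Pow V - {{}}. \<exists>X\<in>Pow (V - S) - {{}}. r \<in> layered_on V S X)
    \<or> (\<exists>X\<in>Pow V. \<exists>x\<in>X. \<exists>S\<in>Pow (V - X). r \<subseteq> S \<times> (X - {x}) \<union> X \<times> (V - X - S))"
proof -
  obtain X S where X: "X \<subseteq> V" "S \<subseteq> V - X" and sub: "r \<subseteq> S \<times> X \<union> X \<times> (V - X - S)"
    using r unfolding three_layered_def by auto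
  have Xne: "X \<noteq> {}"
  proof
    assume "X = {}"
    then have "r = {}" using sub by auto
    then show False using nb ne by (auto simp: nb_def)
  qed
  show ?thesis
  proof (cases "\<exists>x\<in>X. r\<inverse> `` {x} = {}")
    case True
    then obtain x where x: "x \<in> X" "r\<inverse> `` {x} = {}" by auto
    then have "r \<subseteq> S \<times> (X - {x}) \<union> X \<times> (V - X - S)" using sub by auto
    then show ?thesis using x X by auto
  next
    case False
    have "r\<inverse> `` {v} \<noteq> {}" if v: "v \<in> V - S" for v
    proof (cases "v \<in> X")
      case False
      have "r `` {v} = {}" using False sub v by auto
      then show ?thesis using nb[of v] v by (auto simp: nb_def)
    qed (use \<open>\<not> (\<exists>x\<in>X. r\<inverse> `` {x} = {})\<close> in auto)
    then have "r \<in> layered_on V S X" using sub by (simp add: layered_on_def)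
    moreover have "S \<noteq> {}" using False Xne sub X by auto
    moreover have "S \<subseteq> V" "X \<subseteq> V - S" using X by auto
    ultimately show ?thesis using Xne by auto
  qed
qed

text \<open>Such a relation amounts to an independent choice, for every vertex outside
  \<open>S\<close>, of a nonempty set of lower neighbours, taken from \<open>S\<close> for vertices
  of \<open>X\<close> and from \<open>X\<close> for the others.\<close>

lemma card_layered_on:
  assumes V: "finite V" and S: "S \<subseteq> V" and X: "X \<subseteq> V - S"
  shows "card (layered_on V S X) = (2 ^ card S - 1) ^ card X * (2 ^ card X - 1) ^ (card V - card S - card X)"
proof -
  let ?B = "\<lambda>v. if v \<in> X then Pow S - {{}} else Pow X - {{}}"
  let ?P = "Pi\<^sub>E (V - S) ?B"
  have fin: "finite S" "finite X" using V S X finite_subset by (metis, metis finite_Diff)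
  have "bij_betw (\<lambda>r. \<lambda>v\<in>V - S. r\<inverse> `` {v}) (layered_on V S X) ?P"
  proof (rule bij_betwI[where g = "\<lambda>f. {(u, v). v \<in> V - S \<and> u \<in> f v}"])
    show "(\<lambda>r. \<lambda>v\<in>V - S. r\<inverse> `` {v}) \<in> layered_on V S X \<rightarrow> ?P"
    proof (intro Pi_I restrict_PiE_iff[THEN iffD2] ballI)
      fix r v assume r: "r \<in> layered_on V S X" and v: "v \<in> V - S"
      then show "r\<inverse> `` {v} \<in> ?B v" by (auto simp: layered_on_def)
    qed
    show "(\<lambda>f. {(u, v). v \<in> V - S \<and> u \<in> f v}) \<in> ?P \<rightarrow> layered_on V S X"
    proof
      fix f assume f: "f \<in> ?P"
      have fv: "f v \<in> ?B v" if "v \<in> V - S" for v using f that by (rule PiE_mem)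
      have "(u, v) \<in> S \<times> X \<union> X \<times> (V - X - S)" if "v \<in> V - S" "u \<in> f v" for u v
        using fv[OF that(1)] that by (auto split: if_splits)
      moreover have "f v \<noteq> {}" if "v \<in> V - S" for v
        using fv[OF that] by (auto split: if_splits)
      ultimately show "{(u, v). v \<in> V - S \<and> u \<in> f v} \<in> layered_on V S X"
        unfolding layered_on_def by auto
    qed
    show "{(u, v). v \<in> V - S \<and> u \<in> (\<lambda>v\<in>V - S. r\<inverse> `` {v}) v} = r" if "r \<in> layered_on V S X" for r
      using that X by (auto simp: layered_on_def)
    show "(\<lambda>v\<in>V - S. {(u, v). v \<in> V - S \<and> u \<in> f v}\<inverse> `` {v}) = f" if f: "f \<in> ?P" for f
    proof
      fix v show "(\<lambda>v\<in>V - S. {(u, v). v \<in> V - S \<and> u \<in> f v}\<inverse> `` {v}) v = f v"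
        using PiE_arb[OF f, of v] by (cases "v \<in> V - S") auto
    qed
  qed
  then have "card (layered_on V S X) = card ?P" by (rule bij_betw_same_card)
  also have "\<dots> = (\<Prod>v\<in>V - S. card (?B v))" using V by (simp add: card_PiE)
  also have "\<dots> = (\<Prod>v\<in>V - S. if v \<in> X then 2 ^ card S - 1 else 2 ^ card X - 1)"
    using fin by (intro prod.cong) (auto simp: card_Pow)
  also have "\<dots> = (2 ^ card S - 1) ^ card ((V - S) \<inter> {v. v \<in> X}) * (2 ^ card X - 1) ^ card ((V - S) \<inter> - {v. v \<in> X})"
    using V by (subst prod.If_cases) auto
  also have "(V - S) \<inter> {v. v \<in> X} = X" using X by auto
  also have "(V - S) \<inter> - {v. v \<in> X} = V - S - X" by auto
  also have "card (V - S - X) = card V - card S - card X"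
    using V S X fin by (simp add: card_Diff_subset)
  finally show ?thesis .
qed

lemma sum_Pow_card:
  assumes V: "finite V"
  shows "(\<Sum>S\<in>Pow V. f (card S)) = (\<Sum>i\<le>card V. (card V choose i) * (f i :: nat))"
proof -
  have "(\<Sum>i\<le>card V. (card V choose i) * f i) = (\<Sum>i\<le>card V. \<Sum>S\<in>{S \<in> Pow V. card S = i}. f (card S))"
    using n_subsets[OF V] by (intro sum.cong) auto
  also have "\<dots> = (\<Sum>S\<in>Pow V. f (card S))"
    using V by (intro sum.group) (auto intro: card_mono)
  finally show ?thesis ..
qed

lemma sum_Pow_nonempty_card:
  assumes V: "finite V"
  shows "(\<Sum>S\<in>Pow V - {{}}. f (card S)) = (\<Sum>i=1..card V. (card V choose i) * (f i :: nat))"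
proof -
  let ?g = "\<lambda>i. if i = 0 then 0 else f i"
  have "(\<Sum>S\<in>Pow V - {{}}. f (card S)) = (\<Sum>S\<in>Pow V - {{}}. ?g (card S))"
    using V finite_subset by (intro sum.cong) (auto simp: card_eq_0_iff)
  also have "\<dots> = (\<Sum>S\<in>Pow V. ?g (card S))"
    using V by (intro sum.mono_neutral_left) auto
  also have "\<dots> = (\<Sum>i\<le>card V. (card V choose i) * ?g i)" by (rule sum_Pow_card[OF V])
  also have "\<dots> = (\<Sum>i=1..card V. (card V choose i) * f i)"
    by (intro sum.mono_neutral_cong_right) auto
  finally show ?thesis .
qed

definition layer_count :: "nat \<Rightarrow> nat" where
  "layer_count n = (\<Sum>i=1..n. (n choose i) * (\<Sum>j=1..n-i. ((n - i) choose j) * ((2 ^ i - 1) ^ j * (2 ^ j - 1) ^ (n - i - j))))"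

lemma sum_card_layered_on:
  assumes V: "finite V"
  shows "(\<Sum>S\<in>Pow V - {{}}. \<Sum>X\<in>Pow (V - S) - {{}}. card (layered_on V S X)) = layer_count (card V)"
proof -
  let ?n = "card V"
  have "(\<Sum>X\<in>Pow (V - S) - {{}}. card (layered_on V S X))
     = (\<Sum>j=1..?n - card S. ((?n - card S) choose j) * ((2 ^ card S - 1) ^ j * (2 ^ j - 1) ^ (?n - card S - j)))"
    if S: "S \<in> Pow V" for S
  proof -
    have "card (V - S) = ?n - card S" using S V finite_subset by (auto intro: card_Diff_subset)
    moreover have "(\<Sum>X\<in>Pow (V - S) - {{}}. card (layered_on V S X))
      = (\<Sum>X\<in>Pow (V - S) - {{}}. (2 ^ card S - 1) ^ card X * (2 ^ card X - 1) ^ (?n - card S - card X))"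
      using S V by (intro sum.cong) (auto simp: card_layered_on)
    ultimately show ?thesis
      using sum_Pow_nonempty_card[of "V - S" "\<lambda>j. (2 ^ card S - 1) ^ j * (2 ^ j - 1) ^ (?n - card S - j)"] V
      by simp
  qed
  then have "(\<Sum>S\<in>Pow V - {{}}. \<Sum>X\<in>Pow (V - S) - {{}}. card (layered_on V S X))
    = (\<Sum>S\<in>Pow V - {{}}. \<Sum>j=1..?n - card S. ((?n - card S) choose j) * ((2 ^ card S - 1) ^ j * (2 ^ j - 1) ^ (?n - card S - j)))"
    by (intro sum.cong) auto
  also have "\<dots> = layer_count ?n"
    unfolding layer_count_def by (rule sum_Pow_nonempty_card[OF V])
  finally show ?thesis .
qed

lemma finite_layered_on: "finite V \<Longrightarrow> S \<subseteq> V \<Longrightarrow> X \<subseteq> V \<Longrightarrow> finite (layered_on V S X)"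
  by (rule finite_subset[of _ "Pow (V \<times> V)"]) (auto simp: layered_on_def)

definition layered_rels :: "'a set \<Rightarrow> 'a rel set" where
  "layered_rels V = (\<Union>S\<in>Pow V - {{}}. \<Union>X\<in>Pow (V - S) - {{}}. layered_on V S X)"

lemma card_layered_rels:
  assumes V: "finite V" shows "card (layered_rels V) \<le> layer_count (card V)"
proof -
  have "card (layered_rels V) \<le> (\<Sum>S\<in>Pow V - {{}}. card (\<Union>X\<in>Pow (V - S) - {{}}. layered_on V S X))"
    unfolding layered_rels_def using V by (intro card_UN_le) auto
  also have "\<dots> \<le> (\<Sum>S\<in>Pow V - {{}}. \<Sum>X\<in>Pow (V - S) - {{}}. card (layered_on V S X))"
    using V by (intro sum_mono card_UN_le) auto
  finally show ?thesis using sum_card_layered_on[OF V] by simp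
qed

text \<open>For fixed \<open>X\<close> with \<open>x\<close> elements there are
  \<open>x (n - x)\<close> possible edges however the rest is split into outer layers. The split
  contributes \<open>n - x\<close> more bits, and \<open>(x + 1) (n - x)\<close> is at most
  \<open>(n + 1)^2 / 4\<close>.\<close>

lemma card_layered_rels_upper:
  assumes V: "finite V"
  shows "real (card (layered_rels V)) \<le> 2 ^ card V * 2 powr ((real (card V) + 1) ^ 2 / 4)"
proof -
  let ?U = "\<Union>X\<in>Pow V. \<Union>S\<in>Pow (V - X). Pow (S \<times> X \<union> X \<times> (V - X - S))"
  have "layered_rels V \<subseteq> ?U"
  proof
    fix r assume "r \<in> layered_rels V"
    then obtain S X where SX: "S \<in> Pow V" "X \<in> Pow (V - S)" and r: "r \<in> layered_on V S X"
      unfolding layered_rels_def by auto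
    have "X \<in> Pow V" "S \<in> Pow (V - X)" using SX by auto
    moreover have "r \<in> Pow (S \<times> X \<union> X \<times> (V - X - S))" using r by (simp add: layered_on_def)
    ultimately show "r \<in> ?U" by (intro UN_I[of X] UN_I[of S])
  qed
  moreover have "finite ?U"
  proof (rule finite_subset)
    show "?U \<subseteq> Pow (V \<times> V)"
    proof (intro UN_least)
      fix X S assume "X \<in> Pow V" "S \<in> Pow (V - X)"
      then have "S \<times> X \<union> X \<times> (V - X - S) \<subseteq> V \<times> V" by auto
      then show "Pow (S \<times> X \<union> X \<times> (V - X - S)) \<subseteq> Pow (V \<times> V)" by (rule Pow_mono)
    qed
  qed (use V in simp)
  ultimately have "real (card (layered_rels V)) \<le> real (card ?U)" by (intro of_nat_mono card_mono)
  also have "\<dots> \<le> 2 ^ card V * 2 powr ((real (card V) + 1) ^ 2 / 4)"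
  proof (intro card_UN_bound[of "Pow V"])
    fix X assume X: "X \<in> Pow V"
    then have fX: "finite X" "card X \<le> card V" using V finite_subset by (auto intro: card_mono)
    let ?x = "card X" and ?n = "card V"
    have "real (card (\<Union>S\<in>Pow (V - X). Pow (S \<times> X \<union> X \<times> (V - X - S)))) \<le> 2 ^ (?n - ?x) * 2 ^ (?x * (?n - ?x))"
    proof (rule card_UN_bound)
      show "real (card (Pow (V - X))) \<le> 2 ^ (?n - ?x)"
        using V fX X by (simp add: card_Pow card_Diff_subset)
      fix S assume S: "S \<in> Pow (V - X)"
      then have fS: "finite S" "card S \<le> ?n - ?x"
        using V fX X finite_subset[of S "V - X"] card_mono[of "V - X" S] by (auto simp: card_Diff_subset)
      have "card (S \<times> X \<union> X \<times> (V - X - S)) = card S * ?x + ?x * (?n - ?x - card S)"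
        using V fX X S fS by (subst card_Un_disjoint) (auto simp: card_cartesian_product card_Diff_subset)
      also have "\<dots> = ?x * (card S + (?n - ?x - card S))" by (simp only: distrib_left mult.commute)
      also have "\<dots> = ?x * (?n - ?x)" using fS(2) by (simp only: le_add_diff_inverse)
      finally show "real (card (Pow (S \<times> X \<union> X \<times> (V - X - S)))) \<le> 2 ^ (?x * (?n - ?x))"
        using V fX fS by (simp add: card_Pow)
    qed (use V in auto)
    also have "\<dots> = 2 ^ ((?n - ?x) * ((?n + 1) - (?n - ?x)))"
      using fX by (simp add: power_add[symmetric] algebra_simps)
    also have "\<dots> \<le> 2 powr ((real ?n + 1) ^ 2 / 4)"
      using two_power_mult_le[of "?n - ?x" "?n + 1"] by (simp add: add.commute)
    finally show "real (card (\<Union>S\<in>Pow (V - X). Pow (S \<times> X \<union> X \<times> (V - X - S)))) \<le> 2 powr ((real ?n + 1) ^ 2 / 4)" .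
  qed (use V in \<open>auto simp: card_Pow\<close>)
  finally show ?thesis .
qed

definition defective_rels :: "'a set \<Rightarrow> 'a rel set" where
  "defective_rels V = (\<Union>X\<in>Pow V. \<Union>x\<in>X. \<Union>S\<in>Pow (V - X). Pow (S \<times> (X - {x}) \<union> X \<times> (V - X - S)))"

text \<open>The vertex \<open>x\<close> loses \<open>card S\<close> possible edges, so the split
  \<open>S\<close> gets the weight \<open>(1/2) ^ card S\<close>. Summing over all splits gives 3/2
  instead of 2 per vertex outside \<open>X\<close>, which is an exponential saving.\<close>

lemma card_defective_rels:
  assumes V: "finite V"
  shows "real (card (defective_rels V))
    \<le> 2 ^ card V * (card V * 2 powr (real (card V) ^ 2 / 4 + 3/10 * card V + 9/100))"
proof -
  let ?n = "card V"
  let ?b = "2 powr (real ?n ^ 2 / 4 + 3/10 * ?n + 9/100)"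
  show ?thesis
    unfolding defective_rels_def
  proof (rule card_UN_bound)
    show "real (card (Pow V)) \<le> 2 ^ ?n" using V by (simp add: card_Pow)
    fix X assume X: "X \<in> Pow V"
    then have fX: "finite X" "card X \<le> ?n" using V finite_subset by (auto intro: card_mono)
    let ?x = "card X"
    show "real (card (\<Union>x\<in>X. \<Union>S\<in>Pow (V - X). Pow (S \<times> (X - {x}) \<union> X \<times> (V - X - S)))) \<le> ?n * ?b"
    proof (rule card_UN_bound)
      fix x assume x: "x \<in> X"
      have x1: "?x \<ge> 1" using x fX by (simp add: Suc_leI card_gt_0_iff ex_in_conv[symmetric] exI[of _ x])
      have "real (card (\<Union>S\<in>Pow (V - X). Pow (S \<times> (X - {x}) \<union> X \<times> (V - X - S))))
        \<le> real (\<Sum>S\<in>Pow (V - X). card (Pow (S \<times> (X - {x}) \<union> X \<times> (V - X - S))))"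
        using V by (intro of_nat_mono card_UN_le) auto
      also have "\<dots> = (\<Sum>S\<in>Pow (V - X). 2 ^ (?x * (?n - ?x)) * (1/2) ^ card S)"
        unfolding of_nat_sum
      proof (rule sum.cong)
        fix S assume S: "S \<in> Pow (V - X)"
        then have fS: "finite S" "card S \<le> ?n - ?x"
          using V fX X finite_subset[of S "V - X"] card_mono[of "V - X" S] by (auto simp: card_Diff_subset)
        have "card (S \<times> (X - {x}) \<union> X \<times> (V - X - S)) = card S * (?x - 1) + ?x * (?n - ?x - card S)"
          using V fX X S fS x by (subst card_Un_disjoint) (auto simp: card_cartesian_product card_Diff_subset)
        then have "card (S \<times> (X - {x}) \<union> X \<times> (V - X - S)) + card S = card S * ((?x - 1) + 1) + ?x * (?n - ?x - card S)"
          by simp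
        also have "\<dots> = ?x * (card S + (?n - ?x - card S))" using x1 by (simp only: distrib_left mult.commute le_add_diff_inverse2)
        also have "\<dots> = ?x * (?n - ?x)" using fS(2) by (simp only: le_add_diff_inverse)
        finally have "(2::real) ^ (card (S \<times> (X - {x}) \<union> X \<times> (V - X - S)) + card S) = 2 ^ (?x * (?n - ?x))" by simp
        then show "real (card (Pow (S \<times> (X - {x}) \<union> X \<times> (V - X - S)))) = 2 ^ (?x * (?n - ?x)) * (1/2) ^ card S"
          using V fX fS by (simp add: card_Pow power_add power_one_over field_simps)
      qed simp
      also have "\<dots> = 2 ^ (?x * (?n - ?x)) * (3/2) ^ (?n - ?x)"
        using sum_power_card_Pow[of "V - X" "1/2"] V X fX
        by (simp add: sum_distrib_left[symmetric] card_Diff_subset)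
      also have "\<dots> \<le> 2 ^ (?x * (?n - ?x)) * (2 powr (3/5)) ^ (?n - ?x)"
      proof (intro mult_left_mono power_mono)
        \<comment> \<open>The exponent 3/5 is admissible because
          \<open>(3/2) ^ 5 < 8\<close>.\<close>
        have "(3/2 :: real) = ((3/2) powr 5) powr (1/5)" unfolding powr_powr by simp
        also have "\<dots> \<le> (2 powr 3) powr (1/5)"
          by (intro powr_mono2) (simp_all add: power_divide)
        finally show "(3/2 :: real) \<le> 2 powr (3/5)" unfolding powr_powr by simp
      qed simp_all
      also have "2 ^ (?x * (?n - ?x)) * (2 powr (3/5)) ^ (?n - ?x) = 2 powr (real (?x * (?n - ?x)) + 3/5 * real (?n - ?x))"
        by (simp add: powr_add powr_realpow[symmetric] powr_powr mult.commute)
      also have "\<dots> \<le> ?b"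
      proof (rule powr_mono)
        have "real ?x * (real ?n - real ?x) + 3/5 * (real ?n - ?x)
           = real ?n ^ 2 / 4 + 3/10 * ?n + 9/100 - (real ?n / 2 - ?x - 3/10) ^ 2"
          by (simp add: power2_eq_square field_simps)
        then show "real (?x * (?n - ?x)) + 3/5 * real (?n - ?x) \<le> real ?n ^ 2 / 4 + 3/10 * ?n + 9/100"
          using fX by (simp add: of_nat_diff)
      qed simp
      finally show "real (card (\<Union>S\<in>Pow (V - X). Pow (S \<times> (X - {x}) \<union> X \<times> (V - X - S)))) \<le> ?b" .
    qed (use fX in auto)
  qed (use V in auto)
qed

section \<open>Covering digraphs and layered orders\<close>

definition covers :: "'a rel \<Rightarrow> 'a rel" where
  "covers R = R - R O R"

lemma game_onD:
  assumes "game_on V R"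
  shows "R \<subseteq> V \<times> V" "(x, x) \<notin> R" "(x, y) \<in> R \<Longrightarrow> (y, z) \<in> R \<Longrightarrow> (x, z) \<in> R"
proof -
  show "R \<subseteq> V \<times> V" using assms by (simp add: game_on_def)
  then show "(x, x) \<notin> R" using assms by (auto simp: game_on_def irrefl_on_def)
  show "(x, y) \<in> R \<Longrightarrow> (y, z) \<in> R \<Longrightarrow> (x, z) \<in> R" using assms by (auto simp: game_on_def dest: transD)
qed

lemma covers_tames:
  assumes R: "game_on V R" shows "covers R \<in> tames V"
proof -
  note D = game_onD[OF R]
  have c: "(x, y) \<in> covers R \<Longrightarrow> (x, y) \<in> R" for x y by (simp add: covers_def)
  have nc: "(x, y) \<in> R \<Longrightarrow> (y, z) \<in> R \<Longrightarrow> (x, z) \<notin> covers R" for x y z by (auto simp: covers_def)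
  have "tame (covers R)"
  proof (rule tameI)
    show "(y, x) \<notin> covers R" if "(x, y) \<in> covers R" for x y
      using c c D(2,3) that by metis
    show "z \<notin> nb (covers R) x" if "y \<in> nb (covers R) x" "z \<in> nb (covers R) y" for x y z
    proof
      assume z: "z \<in> nb (covers R) x"
      have xy: "(x, y) \<in> covers R \<or> (y, x) \<in> covers R" and yz: "(y, z) \<in> covers R \<or> (z, y) \<in> covers R"
        and xz: "(x, z) \<in> covers R \<or> (z, x) \<in> covers R"
        using that z by (simp_all add: mem_nb)
      show False
        using xy yz xz c nc D(2,3) by metis
    qed
    show "d \<notin> nb (covers R) a" if "(a, b) \<in> covers R" "(b, c) \<in> covers R" "(c, d) \<in> covers R" for a b c d
    proof -
      have "(a, b) \<in> R" "(b, d) \<in> R" using that \<open>\<And>y x. (x, y) \<in> covers R \<Longrightarrow> (x, y) \<in> R\<close> D(3) by metis+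
      then have "(a, d) \<notin> covers R" "(d, a) \<notin> R" using nc D(2,3) by metis+
      then show ?thesis using \<open>\<And>y x. (x, y) \<in> covers R \<Longrightarrow> (x, y) \<in> R\<close> by (auto simp: mem_nb)
    qed
  qed
  then show ?thesis using D(1) by (auto simp: tames_def covers_def)
qed

text \<open>Induction on the number of elements strictly between \<open>x\<close> and
  \<open>y\<close>: an intermediate \<open>w\<close> splits the pair into two pairs with fewer
  elements between them.\<close>

lemma trancl_covers:
  assumes V: "finite V" and R: "game_on V R" shows "(covers R)\<^sup>+ = R"
proof
  note D = game_onD[OF R]
  have "(covers R)\<^sup>+ \<subseteq> R\<^sup>+" by (rule trancl_mono_subset) (auto simp: covers_def)
  also have "R\<^sup>+ = R" using R by (simp add: game_on_def trancl_id)
  finally show "(covers R)\<^sup>+ \<subseteq> R" .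
  have fin: "finite {z. (x, z) \<in> R \<and> (z, y) \<in> R}" for x y
    using D(1) by (intro finite_subset[OF _ V]) auto
  have "(x, y) \<in> R \<Longrightarrow> (x, y) \<in> (covers R)\<^sup>+" for x y
  proof (induction "card {z. (x, z) \<in> R \<and> (z, y) \<in> R}" arbitrary: x y rule: less_induct)
    case less
    show ?case
    proof (cases "(x, y) \<in> covers R")
      case False
      then obtain w where w: "(x, w) \<in> R" "(w, y) \<in> R" using less.prems by (auto simp: covers_def)
      have "{z. (x, z) \<in> R \<and> (z, w) \<in> R} \<subset> {z. (x, z) \<in> R \<and> (z, y) \<in> R}"
        using w D(2)[of w] D(3) by (intro psubsetI subsetI) auto
      then have "(x, w) \<in> (covers R)\<^sup>+" using w fin by (intro less.hyps psubset_card_mono) auto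
      moreover have "{z. (w, z) \<in> R \<and> (z, y) \<in> R} \<subset> {z. (x, z) \<in> R \<and> (z, y) \<in> R}"
        using w D(2)[of w] D(3) by (intro psubsetI subsetI) auto
      then have "(w, y) \<in> (covers R)\<^sup>+" using w fin by (intro less.hyps psubset_card_mono) auto
      ultimately show ?thesis by (rule trancl_trans)
    qed auto
  qed
  then show "R \<subseteq> (covers R)\<^sup>+" by auto
qed

lemma G_le_tame_count: "G n \<le> tame_count n"
  unfolding G_def tame_count_def
proof (rule card_inj_on_le)
  show "inj_on covers {R. game_on {0..<n} R}"
    by (rule inj_on_inverseI[of _ trancl]) (simp add: trancl_covers[of "{0..<n}"])
  show "covers ` {R. game_on {0..<n} R} \<subseteq> tames {0..<n}" using covers_tames by auto
qed (simp add: finite_tames)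

section \<open>Layered orders as games\<close>

lemma finite_games: "finite V \<Longrightarrow> finite {R. game_on V R}"
  by (rule finite_subset[of _ "Pow (V \<times> V)"]) (auto simp: game_on_def)

text \<open>Adding all pairs from the lowest to the highest layer makes the relation transitive. The
  layers can be read off from the result: \<open>S\<close> consists of the elements with nothing
  below them and the highest layer of those reached in two steps, since every vertex outside
  \<open>S\<close> has a lower neighbour in \<open>r\<close>. Removing the added pairs gives
  \<open>r\<close> back.\<close>

lemma layer_count_le_card_games:
  assumes V: "finite V" shows "layer_count (card V) \<le> card {R. game_on V R}"
proof -
  let ?I = "SIGMA S : Pow V - {{}}. SIGMA X : Pow (V - S) - {{}}. layered_on V S X"
  let ?f = "\<lambda>(S, X, r). r \<union> S \<times> (V - X - S)"
  have fin: "finite (layered_on V S X)" if "S \<in> Pow V - {{}}" "X \<in> Pow (V - S) - {{}}" for S X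
    using that by (intro finite_layered_on V) auto
  have rec: "S = V - Range (?f (S, X, r))" "V - X - S = Range (?f (S, X, r) O ?f (S, X, r))"
    if SX: "S \<in> Pow V - {{}}" "X \<in> Pow (V - S) - {{}}" and r: "r \<in> layered_on V S X" for S X r
  proof -
    have sub: "r \<subseteq> S \<times> X \<union> X \<times> (V - X - S)" and ne: "\<And>v. v \<in> V - S \<Longrightarrow> \<exists>u. (u, v) \<in> r"
      using r unfolding layered_on_def by auto
    let ?R = "r \<union> S \<times> (V - X - S)"
    have Rsub: "?R \<subseteq> S \<times> X \<union> (S \<union> X) \<times> (V - X - S)" using sub by auto
    have "Range ?R \<subseteq> V - S"
      using Range_mono[OF Rsub] SX by auto
    moreover have "V - S \<subseteq> Range ?R"
    proof
      fix v assume "v \<in> V - S"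
      then obtain u where "(u, v) \<in> r" using ne by metis
      then show "v \<in> Range ?R" by (intro RangeI[of u]) simp
    qed
    moreover have "S \<subseteq> V" using SX by simp
    ultimately show "S = V - Range (?f (S, X, r))" by (simp add: double_diff)
    have "V - X - S \<subseteq> Range (?R O ?R)"
    proof
      fix v assume v: "v \<in> V - X - S"
      then obtain u where u: "(u, v) \<in> r" using ne by (metis Diff_iff)
      then have "u \<in> X" using sub v by auto
      then have "u \<in> V - S" using SX(2) by auto
      then obtain s where "(s, u) \<in> r" using ne by metis
      then show "v \<in> Range (?R O ?R)" using u by (intro RangeI[of s] relcompI[of s u]) simp_all
    qed
    moreover have "Range (?R O ?R) \<subseteq> V - X - S"
    proof
      fix v assume "v \<in> Range (?R O ?R)"
      then obtain s u where su: "(s, u) \<in> ?R" "(u, v) \<in> ?R" by auto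
      have "u \<notin> S" using subsetD[OF Rsub su(1)] SX by auto
      then show "v \<in> V - X - S" using subsetD[OF Rsub su(2)] by auto
    qed
    ultimately show "V - X - S = Range (?f (S, X, r) O ?f (S, X, r))" by simp
  qed
  have inj: "inj_on ?f ?I"
  proof (rule inj_onI)
    fix p q assume p: "p \<in> ?I" and q: "q \<in> ?I" and eq: "?f p = ?f q"
    obtain S X r where P: "p = (S, X, r)" by (metis surj_pair)
    obtain S' X' r' where Q: "q = (S', X', r')" by (metis surj_pair)
    have P': "S \<in> Pow V - {{}}" "X \<in> Pow (V - S) - {{}}" "r \<in> layered_on V S X" using p P by auto
    have Q': "S' \<in> Pow V - {{}}" "X' \<in> Pow (V - S') - {{}}" "r' \<in> layered_on V S' X'" using q Q by auto
    have S: "S = S'" using rec(1)[OF P'] rec(1)[OF Q'] eq P Q by metis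
    have "V - X - S = V - X' - S'" using rec(2)[OF P'] rec(2)[OF Q'] eq P Q by metis
    then have X: "X = X'" using P'(1,2) Q'(1,2) S by blast
    have "r = (r \<union> S \<times> (V - X - S)) - S \<times> (V - X - S)" if "r \<in> layered_on V S X" "X \<subseteq> V - S" for r
      using that by (auto simp: layered_on_def)
    then have "r = ?f p - S \<times> (V - X - S)" "r' = ?f q - S \<times> (V - X - S)"
      using P' Q' S X P Q by auto
    then show "p = q" using eq P Q S X by simp
  qed
  have img: "?f ` ?I \<subseteq> {R. game_on V R}"
  proof
    fix R assume "R \<in> ?f ` ?I"
    then obtain S X r where SX: "S \<in> Pow V - {{}}" "X \<in> Pow (V - S) - {{}}" and r: "r \<in> layered_on V S X"
      and R: "R = r \<union> S \<times> (V - X - S)" by auto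
    have sub: "r \<subseteq> S \<times> X \<union> X \<times> (V - X - S)" using r unfolding layered_on_def by auto
    have Rsub: "R \<subseteq> S \<times> X \<union> X \<times> (V - X - S) \<union> S \<times> (V - X - S)" using sub R by auto
    have "R \<subseteq> V \<times> V" using Rsub SX by auto
    moreover have "irrefl_on V R" unfolding irrefl_on_def using Rsub SX by auto
    moreover have "trans R"
    proof (rule transI)
      fix x y z assume "(x, y) \<in> R" "(y, z) \<in> R"
      then have "x \<in> S" "z \<in> V - X - S" using Rsub SX by blast+
      then show "(x, z) \<in> R" using R by auto
    qed
    ultimately show "R \<in> {R. game_on V R}" by (simp add: game_on_def)
  qed
  have "layer_count (card V) = card ?I"
    unfolding sum_card_layered_on[OF V, symmetric] using V fin
    by (subst card_SigmaI; (intro ballI finite_SigmaI)?) (auto simp: card_SigmaI)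
  also have "\<dots> = card (?f ` ?I)" using inj by (simp add: card_image)
  also have "\<dots> \<le> card {R. game_on V R}" using img finite_games[OF V] by (intro card_mono)
  finally show ?thesis .
qed

section \<open>Asymptotics\<close>

lemma layered_rels_subset: "layered_rels V \<subseteq> Pow (V \<times> V)"
  unfolding layered_rels_def
proof (intro UN_least subsetI PowI)
  fix S X r p assume "S \<in> Pow V - {{}}" "X \<in> Pow (V - S) - {{}}" "r \<in> layered_on V S X" "p \<in> r"
  then show "p \<in> V \<times> V" unfolding layered_on_def by auto
qed

lemma defective_rels_subset: "defective_rels V \<subseteq> Pow (V \<times> V)"
  unfolding defective_rels_def
proof (intro UN_least subsetI PowI)
  fix X x S r p assume "X \<in> Pow V" "S \<in> Pow (V - X)" "r \<in> Pow (S \<times> (X - {x}) \<union> X \<times> (V - X - S))" "p \<in> r"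
  then show "p \<in> V \<times> V" by auto
qed

lemma tames_cases:
  assumes V: "finite V" and large: "real (card V) \<ge> 10 ^ 8"
  shows "tames V \<subseteq> {r \<in> tames V. \<exists>v\<in>V. real (card (nb r v)) < card V / 32}
    \<union> {r \<in> tames V. (\<forall>v\<in>V. real (card (nb r v)) \<ge> card V / 32) \<and> \<not> no_gap 300000 (1/131072) (1/4096) V r}
    \<union> {r \<in> tames V. (\<forall>v\<in>V. real (card (nb r v)) \<ge> card V / 32) \<and> \<not> no_gap 300000 (7/8192) (1/64) V r}
    \<union> {r. two_layerish (7/8192) V r} \<union> defective_rels V \<union> layered_rels V" (is "_ \<subseteq> ?A \<union> ?B \<union> ?C \<union> ?D \<union> _ \<union> _")
proof
  fix r assume r: "r \<in> tames V"
  show "r \<in> ?A \<union> ?B \<union> ?C \<union> ?D \<union> defective_rels V \<union> layered_rels V"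
  proof (cases "r \<in> ?A \<union> ?B \<union> ?C \<union> ?D")
    case False
    then have deg: "real (card (nb r v)) \<ge> card V / 32" if "v \<in> V" for v
      using r that by (auto simp: not_less)
    interpret robust V r
      using V r large deg False by unfold_locales auto
    have "three_layered V r" using layered False by auto
    moreover have "nb r v \<noteq> {}" if "v \<in> V" for v
    proof
      assume "nb r v = {}"
      then show False using deg[OF that] large by simp
    qed
    moreover have "V \<noteq> {}" using large by auto
    ultimately have "(\<exists>S\<in>Pow V - {{}}. \<exists>X\<in>Pow (V - S) - {{}}. r \<in> layered_on V S X)
      \<or> (\<exists>X\<in>Pow V. \<exists>x\<in>X. \<exists>S\<in>Pow (V - X). r \<subseteq> S \<times> (X - {x}) \<union> X \<times> (V - X - S))"
      by (rule three_layered_cases)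
    then show ?thesis
    proof
      assume "\<exists>S\<in>Pow V - {{}}. \<exists>X\<in>Pow (V - S) - {{}}. r \<in> layered_on V S X"
      then show ?thesis unfolding layered_rels_def UN_iff Un_iff by simp
    next
      assume "\<exists>X\<in>Pow V. \<exists>x\<in>X. \<exists>S\<in>Pow (V - X). r \<subseteq> S \<times> (X - {x}) \<union> X \<times> (V - X - S)"
      then show ?thesis unfolding defective_rels_def UN_iff Un_iff Pow_iff by simp
    qed
  qed simp
qed

lemma power_le_exponential:
  fixes c D :: real
  assumes c: "c > 0"
  shows "eventually (\<lambda>n. D * (real n + 1) ^ J \<le> 2 powr (c * n)) sequentially"
proof -
  define a where "a = c * ln 2"
  define E where "E = a ^ J / (max D 1 * 2 powr c)"
  have a: "a > 0" using c by (simp add: a_def)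
  have E: "E > 0" using a by (simp add: E_def)
  have "filterlim (\<lambda>n. a * (real n + 1)) at_top sequentially"
    by (intro filterlim_tendsto_pos_mult_at_top[OF tendsto_const a]
        filterlim_at_top_mono[OF filterlim_real_sequentially]) simp
  then have "(\<lambda>n. (a * (real n + 1)) ^ J / exp (a * (real n + 1))) \<longlonglongrightarrow> 0"
    by (rule filterlim_compose[OF tendsto_power_div_exp_0])
  then have "eventually (\<lambda>n. (a * (real n + 1)) ^ J / exp (a * (real n + 1)) < E) sequentially"
    using E by (rule order_tendstoD)
  then show ?thesis
  proof eventually_elim
    case (elim n)
    have e: "exp (a * (real n + 1)) = 2 powr c * 2 powr (c * n)"
      by (simp add: a_def powr_def exp_add[symmetric] algebra_simps)
    have "a ^ J * (real n + 1) ^ J < E * (2 powr c * 2 powr (c * n))"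
      using elim unfolding e[symmetric] power_mult_distrib by (simp add: pos_divide_less_eq)
    also have "\<dots> = a ^ J * (2 powr (c * n) / max D 1)" by (simp add: E_def)
    finally have "(real n + 1) ^ J < 2 powr (c * n) / max D 1"
      by (rule mult_left_less_imp_less) (use a in simp)
    then have "max D 1 * (real n + 1) ^ J < 2 powr (c * n)" by (simp add: field_simps)
    moreover have "D * (real n + 1) ^ J \<le> max D 1 * (real n + 1) ^ J" by (intro mult_right_mono) auto
    ultimately show ?case by linarith
  qed
qed

text \<open>The growth of the number of orders up to a polynomial factor.\<close>

definition rate :: "nat \<Rightarrow> real" where
  "rate n = 2 powr (real n ^ 2 / 4 + 3 / 2 * n)"

text \<open>The tightest saving is that of the first level: 1/4096 exceeds
  \<open>14 * (1/131072) + 2 / 2 ^ 14\<close> by only \<open>1 / 2 ^ 16\<close>. Twice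
  \<open>gain\<close> stays below this, so that one \<open>gain\<close> can pay for polynomial
  factors and one is left over.\<close>

definition gain :: real where "gain = 1 / 2 ^ 20"

lemma gap_terms_small:
  "eventually (\<lambda>n. real n * 2 powr (3/10 * n)
     + real n * ((real n + 1) ^ 300000 * 6) ^ 2 * ((real n + 1) ^ 131072) ^ 2
       * (2 powr ((1/2 - 1/4096) * n) * 2 powr ((14 * (1/131072) + 2 / 2 ^ 14) * n))
     + real n * ((real n + 1) ^ 300000 * 6) ^ 2 * ((real n + 1) ^ 131072) ^ 2
       * (2 powr ((1/2 - 1/64) * n) * 2 powr ((8 * (7/8192) + 2 / 2 ^ 8) * n))
     \<le> 2 powr ((1/2 - gain) * n)) sequentially"
proof -
  define k K :: nat where "k = 300000" and "K = 131072"
  have "gain > 0" by (simp add: gain_def)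
  \<comment> \<open>The factor 36 is the square of the 6 from \<open>card_definable\<close>, and
    each of the three summands is allowed a third of the bound.\<close>
  then have "eventually (\<lambda>n. 108 * (real n + 1) ^ (1 + 2 * k + 2 * K) \<le> 2 powr (gain * n)) sequentially"
    by (rule power_le_exponential)
  then have "eventually (\<lambda>n. real n * 2 powr (3/10 * n)
     + real n * ((real n + 1) ^ k * 6) ^ 2 * ((real n + 1) ^ K) ^ 2
       * (2 powr ((1/2 - 1/4096) * n) * 2 powr ((14 * (1/131072) + 2 / 2 ^ 14) * n))
     + real n * ((real n + 1) ^ k * 6) ^ 2 * ((real n + 1) ^ K) ^ 2
       * (2 powr ((1/2 - 1/64) * n) * 2 powr ((8 * (7/8192) + 2 / 2 ^ 8) * n))
     \<le> 2 powr ((1/2 - gain) * n)) sequentially"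
  proof eventually_elim
    case (elim n)
    let ?P = "36 * (real n + 1) ^ (1 + 2 * k + 2 * K)" and ?Q = "2 powr ((1/2 - 2 * gain) * n)"
    have P: "?P * ?Q \<le> 2 powr ((1/2 - gain) * n) / 3"
    proof -
      have "?P * ?Q \<le> (2 powr (gain * n) / 3) * ?Q" using elim by (intro mult_right_mono) auto
      also have "\<dots> = 2 powr ((1/2 - gain) * n) / 3"
        by (simp add: powr_add[symmetric] algebra_simps)
      finally show ?thesis .
    qed
    have "real n * ((real n + 1) ^ k * 6) ^ 2 * ((real n + 1) ^ K) ^ 2
      \<le> (real n + 1) * ((real n + 1) ^ k * 6) ^ 2 * ((real n + 1) ^ K) ^ 2"
      by (intro mult_right_mono) auto
    also have "\<dots> = ?P"
      by (simp add: power_mult_distrib power_add power_mult[symmetric] mult.commute)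
    finally have p: "real n * ((real n + 1) ^ k * 6) ^ 2 * ((real n + 1) ^ K) ^ 2 \<le> ?P" .
    have "real n \<le> 36 * (real n + 1)" by simp
    also have "(real n + 1) \<le> (real n + 1) ^ (1 + 2 * k + 2 * K)" by (intro self_le_power) auto
    finally have p0: "real n \<le> ?P" by simp
    have q: "2 powr (t * n) \<le> ?Q" if "t \<le> 1/2 - 2 * gain" for t
      using that by (intro powr_mono mult_right_mono) auto
    have 1: "real n * 2 powr (3/10 * n) \<le> ?P * ?Q"
      using p0 by (intro mult_mono q) (auto simp: gain_def)
    have 2: "2 powr ((1/2 - 1/4096) * n) * 2 powr ((14 * (1/131072) + 2 / 2 ^ 14) * n) \<le> ?Q"
      unfolding powr_add[symmetric] distrib_right[symmetric] by (rule q) (simp add: gain_def)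
    have 3: "2 powr ((1/2 - 1/64) * n) * 2 powr ((8 * (7/8192) + 2 / 2 ^ 8) * n) \<le> ?Q"
      unfolding powr_add[symmetric] distrib_right[symmetric] by (rule q) (simp add: gain_def)
    have 4: "real n * ((real n + 1) ^ k * 6) ^ 2 * ((real n + 1) ^ K) ^ 2
       * (2 powr ((1/2 - 1/4096) * n) * 2 powr ((14 * (1/131072) + 2 / 2 ^ 14) * n)) \<le> ?P * ?Q"
      by (rule mult_mono[OF p 2]) auto
    have 5: "real n * ((real n + 1) ^ k * 6) ^ 2 * ((real n + 1) ^ K) ^ 2
       * (2 powr ((1/2 - 1/64) * n) * 2 powr ((8 * (7/8192) + 2 / 2 ^ 8) * n)) \<le> ?P * ?Q"
      by (rule mult_mono[OF p 3]) auto
    show ?case using 1 4 5 P by linarith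
  qed
  then show ?thesis unfolding k_def K_def .
qed

text \<open>Beyond \<open>n^2 / 4\<close> the exponents grow like \<open>(1 + 240/8192) n\<close>
  and \<open>(13/10) n\<close>, both clearly below the \<open>(3/2) n\<close> of
  \<open>rate\<close>.\<close>

lemma direct_terms_small:
  "eventually (\<lambda>n. 2 ^ n * (2 powr ((8 * (7/8192) + 2 / 2 ^ 8) * n) * (2 powr ((8 * (7/8192) + 2 / 2 ^ 8) * n)
        * 2 powr (real n ^ 2 / 4)))
     + 2 ^ n * (n * 2 powr (real n ^ 2 / 4 + 3/10 * n + 9/100))
     \<le> rate n * 2 powr (- gain * n)) sequentially"
proof -
  have "gain > 0" by (simp add: gain_def)
  then have "eventually (\<lambda>n. 4 * (real n + 1) ^ 1 \<le> 2 powr (gain * n)) sequentially"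
    by (rule power_le_exponential)
  then show ?thesis
  proof eventually_elim
    case (elim n)
    let ?u = "real n ^ 2 / 4"
    let ?Q = "2 powr (?u + (3/2 - 2 * gain) * n)"
    have B: "2 powr (gain * n) * ?Q = rate n * 2 powr (- gain * n)"
      unfolding rate_def powr_add[symmetric] by (simp add: algebra_simps)
    have n2: "(2::real) ^ n = 2 powr n" by (simp add: powr_realpow)
    have "2 ^ n * (2 powr ((8 * (7/8192) + 2 / 2 ^ 8) * n) * (2 powr ((8 * (7/8192) + 2 / 2 ^ 8) * n) * 2 powr ?u))
      = 2 powr (?u + (1 + 2 * (8 * (7/8192) + 2 / 2 ^ 8)) * n)"
      unfolding n2 powr_add[symmetric] by (simp add: algebra_simps)
    also have "\<dots> \<le> ?Q" by (intro powr_mono add_left_mono mult_right_mono) (auto simp: gain_def)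
    finally have 1: "2 ^ n * (2 powr ((8 * (7/8192) + 2 / 2 ^ 8) * n) * (2 powr ((8 * (7/8192) + 2 / 2 ^ 8) * n) * 2 powr ?u)) \<le> ?Q" .
    have "2 ^ n * (real n * 2 powr (?u + 3/10 * n + 9/100)) = real n * 2 powr (9/100) * 2 powr (?u + 13/10 * n)"
      unfolding n2 powr_add by (simp add: powr_add[symmetric] algebra_simps)
    also have "\<dots> \<le> real n * 2 * ?Q"
    proof (intro mult_mono)
      have "(2::real) powr (9/100) \<le> 2 powr 1" by (intro powr_mono) auto
      then show "(2::real) powr (9/100) \<le> 2" by simp
      show "2 powr (?u + 13/10 * n) \<le> ?Q" by (intro powr_mono add_left_mono mult_right_mono) (auto simp: gain_def)
    qed auto
    finally have 2: "2 ^ n * (real n * 2 powr (?u + 3/10 * n + 9/100)) \<le> real n * 2 * ?Q" .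
    have "?Q + real n * 2 * ?Q = (1 + 2 * real n) * ?Q" by (simp add: algebra_simps)
    also have "\<dots> \<le> 2 powr (gain * n) * ?Q" using elim by (intro mult_right_mono) auto
    finally show ?case using 1 2 B by linarith
  qed
qed

lemma tame_count_recursion:
  "eventually (\<lambda>n. real (tame_count n) \<le> real (card (layered_rels {0..<n}))
     + real (tame_count (n - 1)) * 2 powr ((1/2 - gain) * n) + rate n * 2 powr (- gain * n)) sequentially"
  using gap_terms_small direct_terms_small eventually_ge_at_top[of "10 ^ 8"]
proof eventually_elim
  case (elim n)
  let ?V = "{0..<n}"
  define A B C D where "A = {r \<in> tames ?V. \<exists>v\<in>?V. real (card (nb r v)) < card ?V / 32}"
    and "B = {r \<in> tames ?V. (\<forall>v\<in>?V. real (card (nb r v)) \<ge> card ?V / 32) \<and> \<not> no_gap 300000 (1/131072) (1/4096) ?V r}"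
    and "C = {r \<in> tames ?V. (\<forall>v\<in>?V. real (card (nb r v)) \<ge> card ?V / 32) \<and> \<not> no_gap 300000 (7/8192) (1/64) ?V r}"
    and "D = {r. two_layerish (7/8192) ?V r}"
  have large: "real (card ?V) \<ge> 10 ^ 8" using elim(3) by simp
  have fin: "finite A" "finite B" "finite C" using finite_tames[of ?V] by (auto simp: A_def B_def C_def)
  have finD: "finite D"
    unfolding D_def two_layerish_def by (rule finite_subset[of _ "Pow (?V \<times> ?V)"]) (blast, simp)
  have finE: "finite (defective_rels ?V)" "finite (layered_rels ?V)"
    by (rule finite_subset[OF defective_rels_subset] finite_subset[OF layered_rels_subset], simp)+
  have "tames ?V \<subseteq> A \<union> B \<union> C \<union> D \<union> defective_rels ?V \<union> layered_rels ?V"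
    unfolding A_def B_def C_def D_def using large by (intro tames_cases) auto
  then have "tame_count n \<le> card (A \<union> B \<union> C \<union> D \<union> defective_rels ?V \<union> layered_rels ?V)"
    unfolding tame_count_def using fin finD finE by (intro card_mono) auto
  also have "\<dots> \<le> card A + card B + card C + card D + card (defective_rels ?V) + card (layered_rels ?V)"
    by (intro order.trans[OF card_Un_le] add_mono order.refl)
  finally have "real (tame_count n) \<le> real (card A) + card B + card C + card D + card (defective_rels ?V) + card (layered_rels ?V)"
    by linarith
  moreover have "real (card A) + card B + card C \<le> real (tame_count (n - 1)) * 2 powr ((1/2 - gain) * n)"
  proof -
    let ?X = "real n * ((real n + 1) ^ 300000 * 6) ^ 2 * ((real n + 1) ^ 131072) ^ 2"
    have "real (card A) \<le> real (tame_count (n - 1)) * (real n * 2 powr (3/10 * n))"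
      using card_low_degree[of ?V] unfolding A_def by (simp only: finite_atLeastLessThan card_atLeastLessThan minus_nat.diff_0 True_implies_equals mult.left_commute)
    moreover have "real (card B) \<le> real (tame_count (n - 1)) * (?X * (2 powr ((1/2 - 1/4096) * n) * 2 powr ((14 * (1/131072) + 2 / 2 ^ 14) * n)))"
      using card_gap[OF _ large, of 300000 "1/131072" "1/4096" 14] unfolding B_def
      by (simp only: finite_atLeastLessThan card_atLeastLessThan minus_nat.diff_0 True_implies_equals mult.left_commute mult.assoc of_nat_numeral of_nat_add of_nat_1)
    moreover have "real (card C) \<le> real (tame_count (n - 1)) * (?X * (2 powr ((1/2 - 1/64) * n) * 2 powr ((8 * (7/8192) + 2 / 2 ^ 8) * n)))"
      using card_gap[OF _ large, of 300000 "7/8192" "1/64" 8] unfolding C_def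
      by (simp only: finite_atLeastLessThan card_atLeastLessThan minus_nat.diff_0 True_implies_equals mult.left_commute mult.assoc of_nat_numeral of_nat_add of_nat_1)
    ultimately have "real (card A) + card B + card C \<le> real (tame_count (n - 1)) * (real n * 2 powr (3/10 * n)
       + ?X * (2 powr ((1/2 - 1/4096) * n) * 2 powr ((14 * (1/131072) + 2 / 2 ^ 14) * n))
       + ?X * (2 powr ((1/2 - 1/64) * n) * 2 powr ((8 * (7/8192) + 2 / 2 ^ 8) * n)))"
      unfolding distrib_left by linarith
    also have "\<dots> \<le> real (tame_count (n - 1)) * 2 powr ((1/2 - gain) * n)"
      using elim(1) by (intro mult_left_mono) auto
    finally show ?thesis .
  qed
  moreover have "real (card D) + card (defective_rels ?V) \<le> rate n * 2 powr (- gain * n)"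
  proof -
    have "real (card D) \<le> 2 ^ n * (2 powr ((8 * (7/8192) + 2 / 2 ^ 8) * n) * (2 powr ((8 * (7/8192) + 2 / 2 ^ 8) * n)
        * 2 powr (real n ^ 2 / 4)))"
      using card_two_layerish[of ?V "7/8192" 8] unfolding D_def
      by (simp only: finite_atLeastLessThan card_atLeastLessThan minus_nat.diff_0 True_implies_equals of_nat_numeral)
    moreover have "real (card (defective_rels ?V)) \<le> 2 ^ n * (n * 2 powr (real n ^ 2 / 4 + 3/10 * n + 9/100))"
      using card_defective_rels[of ?V]
      by (simp only: finite_atLeastLessThan card_atLeastLessThan minus_nat.diff_0 True_implies_equals)
    ultimately show ?thesis using elim(2) by linarith
  qed
  ultimately show ?case by linarith
qed

section \<open>Growth of the number of tame digraphs\<close>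

lemma rate_pos: "rate n > 0"
  by (simp add: rate_def)

lemma rate_step: "n \<ge> 1 \<Longrightarrow> rate (n - 1) * 2 powr (n / 2) \<le> rate n"
  unfolding rate_def powr_add[symmetric]
  by (intro powr_mono) (auto simp: of_nat_diff power2_eq_square field_simps)

lemma layered_le_rate: "real (card (layered_rels {0..<n})) \<le> 2 * rate n"
proof -
  have "real (card (layered_rels {0..<n})) \<le> 2 ^ n * 2 powr ((real n + 1) ^ 2 / 4)"
    using card_layered_rels_upper[of "{0..<n}"] by simp
  also have "\<dots> = 2 powr (1/4) * rate n"
    unfolding rate_def powr_add[symmetric] powr_realpow[of 2 n, simplified, symmetric]
    by (simp add: power2_eq_square field_simps)
  also have "\<dots> \<le> 2 powr 1 * rate n"
    using rate_pos[of n] by (intro mult_right_mono powr_mono) auto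
  finally show ?thesis by simp
qed

text \<open>Divided by \<open>rate\<close>, the recursion says that for large \<open>n\<close> the
  new value is at most 3 plus half the old one: the layered part contributes 2 and the negligible
  part 1. Every bound of at least 6 is preserved by this, so 6 and the finitely many initial values
  suffice.\<close>

lemma tame_count_bounded: "\<exists>C. \<forall>n. real (tame_count n) \<le> C * rate n"
proof -
  have gain: "gain > 0" by (simp add: gain_def)
  have "eventually (\<lambda>n. 2 * (real n + 1) ^ 0 \<le> 2 powr (gain * n)) sequentially"
    using gain by (rule power_le_exponential)
  with tame_count_recursion eventually_ge_at_top[of 1]
  have "eventually (\<lambda>n. real (tame_count n) / rate n \<le> 3 + (real (tame_count (n - 1)) / rate (n - 1)) / 2) sequentially"
  proof eventually_elim
    case (elim n)
    have e: "2 powr (- gain * n) \<le> 1/2"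
      using elim(3) by (simp add: powr_minus field_simps)
    have "2 powr ((1/2 - gain) * n) = 2 powr (n / 2) * 2 powr (- gain * n)"
      unfolding powr_add[symmetric] by (simp add: algebra_simps)
    also have "\<dots> \<le> (rate n / rate (n - 1)) * (1 / 2)"
      using rate_step[of n] elim(2) e rate_pos[of "n - 1"] rate_pos[of n]
      by (intro mult_mono) (auto simp: field_simps)
    finally have "real (tame_count (n - 1)) * 2 powr ((1/2 - gain) * n) \<le> real (tame_count (n - 1)) * ((rate n / rate (n - 1)) * (1 / 2))"
      by (intro mult_left_mono) auto
    moreover have "rate n * 2 powr (- gain * n) \<le> rate n * 1"
      using e rate_pos[of n] by (intro mult_left_mono) auto
    ultimately have "real (tame_count n) \<le> 3 * rate n + real (tame_count (n - 1)) * ((rate n / rate (n - 1)) * (1 / 2))"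
      using elim(1) layered_le_rate[of n] by linarith
    then have "real (tame_count n) / rate n \<le> (3 * rate n + real (tame_count (n - 1)) * ((rate n / rate (n - 1)) * (1 / 2))) / rate n"
      using rate_pos[of n] by (intro divide_right_mono) auto
    also have "\<dots> = 3 + (real (tame_count (n - 1)) / rate (n - 1)) / 2"
      using rate_pos[of n] rate_pos[of "n - 1"] by (simp add: field_simps)
    finally show ?case .
  qed
  then obtain N where N: "\<And>n. n \<ge> N \<Longrightarrow> real (tame_count n) / rate n \<le> 3 + (real (tame_count (n - 1)) / rate (n - 1)) / 2"
    unfolding eventually_sequentially by blast
  define C where "C = Max (insert 6 ((\<lambda>n. real (tame_count n) / rate n) ` {..N}))"
  have C6: "C \<ge> 6" unfolding C_def by (intro Max_ge) auto
  have "real (tame_count n) / rate n \<le> C" for n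
  proof (induction n)
    case 0
    show ?case unfolding C_def by (intro Max_ge) auto
  next
    case (Suc n)
    show ?case
    proof (cases "Suc n \<le> N")
      case True
      then show ?thesis unfolding C_def by (intro Max_ge) auto
    next
      case False
      then show ?thesis using N[of "Suc n"] Suc C6 by simp
    qed
  qed
  then have "\<forall>n. real (tame_count n) \<le> C * rate n"
    using rate_pos by (simp add: pos_divide_le_eq)
  then show ?thesis ..
qed

section \<open>Size of the double sum\<close>

lemma half_power_bound:
  fixes i j :: nat assumes "real (2 * j) \<le> 2 ^ i"
  shows "2 ^ (i * j) / 2 \<le> ((2::real) ^ i - 1) ^ j"
proof -
  have "1/2 \<le> 1 + real j * (- 1 / 2 ^ i)" using assms by (simp add: field_simps)
  also have "\<dots> \<le> (1 + - 1 / 2 ^ i) ^ j" by (rule Bernoulli_inequality) simp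
  finally have "2 ^ (i * j) * (1/2) \<le> (2 ^ i) ^ j * (1 + - 1 / (2::real) ^ i) ^ j"
    unfolding power_mult by (intro mult_left_mono) auto
  also have "\<dots> = (2 ^ i - 1) ^ j"
    unfolding power_mult_distrib[symmetric] by (simp add: right_diff_distrib)
  finally show ?thesis by simp
qed

lemma middle_binomial_bound: "(2::real) ^ n / (real n + 1) \<le> real (n choose (n div 2))"
proof -
  have "2 ^ n = (\<Sum>k\<le>n. n choose k)" by (simp add: choose_row_sum)
  also have "\<dots> \<le> (\<Sum>k\<le>n. n choose (n div 2))" by (intro sum_mono binomial_maximum)
  finally have "2 ^ n \<le> (n + 1) * (n choose (n div 2))" by simp
  then have "real (2 ^ n) \<le> real ((n + 1) * (n choose (n div 2)))" by (simp only: of_nat_le_iff)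
  then show ?thesis by (simp add: field_simps)
qed

lemma real_layer_count:
  "real (layer_count n) = (\<Sum>i=1..n. \<Sum>j=1..n-i. real (n choose i) * real ((n-i) choose j)
        * (2 ^ i - 1) ^ j * (2 ^ j - 1) ^ (n-i-j))"
  unfolding layer_count_def of_nat_sum of_nat_mult sum_distrib_left
  by (intro sum.cong refl) (simp add: of_nat_diff mult.assoc)

lemma choose_swap:
  assumes "i + j \<le> n"
  shows "(n choose i) * ((n - i) choose j) = (n choose j) * ((n - j) choose i)"
proof -
  have "(n choose i) * ((n - i) choose j) = (n choose (i + j)) * ((i + j) choose i)"
    using choose_mult[of i "i + j" n] assms by simp
  also have "(i + j) choose i = (i + j) choose j" using binomial_symmetric[of i "i + j"] by simp
  also have "(n choose (i + j)) * ((i + j) choose j) = (n choose j) * ((n - j) choose i)"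
    using choose_mult[of j "i + j" n] assms by simp
  finally show ?thesis .
qed

text \<open>One summand is enough: half of the vertices in the middle layer and the rest split
  evenly. Choosing the middle layer first makes both binomial coefficients central, each losing at
  most a factor \<open>n + 1\<close>, and excluding empty sets of lower neighbours costs two factors
  of 2 by \<open>half_power_bound\<close>.\<close>

lemma layer_count_lower:
  "eventually (\<lambda>n. rate n / (8 * (real n + 1) ^ 2) \<le> real (layer_count n)) sequentially"
proof -
  have "eventually (\<lambda>n. 4 * (real n + 1) ^ 1 \<le> 2 powr (1/4 * n)) sequentially"
    by (rule power_le_exponential) simp
  then show ?thesis
    using eventually_ge_at_top[of 8]
  proof eventually_elim
    case (elim n)
    define j i where "j = n div 2" and "i = (n - j) div 2"
    have ij: "i \<ge> 1" "j \<ge> 1" "i + j \<le> n" "i \<le> n" "j \<le> n - i" "i \<le> j" using elim(2) unfolding i_def j_def by linarith+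
    have "real i \<ge> n / 4 - 1" unfolding i_def j_def by linarith
    then have "2 powr (1/4 * n) \<le> 2 powr (1 + real i)" by (intro powr_mono) auto
    also have "\<dots> = 2 * 2 ^ i" by (simp add: powr_add powr_realpow)
    finally have i2: "real (2 * n) \<le> 2 ^ i" using elim(1) by simp
    have j2: "(2::real) ^ i \<le> 2 ^ j" using ij by (intro power_increasing) auto
    have hb1: "2 ^ (i * j) / 2 \<le> ((2::real) ^ i - 1) ^ j"
      using i2 ij by (intro half_power_bound) auto
    have hb2: "2 ^ (j * (n - i - j)) / 2 \<le> ((2::real) ^ j - 1) ^ (n - i - j)"
    proof (rule half_power_bound)
      have "real (2 * (n - i - j)) \<le> real (2 * n)" by simp
      then show "real (2 * (n - i - j)) \<le> 2 ^ j" using i2 j2 by linarith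
    qed
    have bin: "(2 ^ n / (real n + 1)) * (2 ^ (n - j) / (real n + 1)) \<le> real (n choose j) * real ((n - j) choose i)"
    proof (intro mult_mono)
      show "2 ^ n / (real n + 1) \<le> real (n choose j)" using middle_binomial_bound[of n] unfolding j_def .
      have "2 ^ (n - j) / (real n + 1) \<le> 2 ^ (n - j) / (real (n - j) + 1)" by (intro divide_left_mono) auto
      also have "\<dots> \<le> real ((n - j) choose i)" using middle_binomial_bound[of "n - j"] unfolding i_def .
      finally show "2 ^ (n - j) / (real n + 1) \<le> real ((n - j) choose i)" .
    qed auto
    have ex: "real n ^ 2 / 4 + 3 / 2 * n - 1/4 \<le> real (n + (n - j) + (i * j + j * (n - i - j)))"
    proof -
      have "i * j + j * (n - i - j) = j * (i + (n - i - j))" by (simp only: distrib_left mult.commute)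
      also have "i + (n - i - j) = n - j" using ij by linarith
      finally have "i * j + j * (n - i - j) = j * (n - j)" .
      moreover have "n = 2 * j \<or> n = 2 * j + 1" unfolding j_def by linarith
      ultimately show ?thesis by (elim disjE) (simp_all add: power2_eq_square field_simps)
    qed
    have "rate n / (8 * (real n + 1) ^ 2) \<le> 2 powr (real n ^ 2 / 4 + 3 / 2 * n - 1/4) / (4 * (real n + 1) ^ 2)"
    proof -
      have "rate n / 2 = 2 powr (real n ^ 2 / 4 + 3 / 2 * n - 1)" unfolding rate_def by (simp add: powr_diff)
      also have "\<dots> \<le> 2 powr (real n ^ 2 / 4 + 3 / 2 * n - 1/4)" by (intro powr_mono) auto
      finally have "rate n / 2 / (4 * (real n + 1) ^ 2) \<le> 2 powr (real n ^ 2 / 4 + 3 / 2 * n - 1/4) / (4 * (real n + 1) ^ 2)"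
        by (intro divide_right_mono) auto
      then show ?thesis by simp
    qed
    also have "\<dots> \<le> 2 powr real (n + (n - j) + (i * j + j * (n - i - j))) / (4 * (real n + 1) ^ 2)"
      using ex by (intro divide_right_mono powr_mono) auto
    also have "\<dots> = (2 ^ n / (real n + 1)) * (2 ^ (n - j) / (real n + 1)) * ((2 ^ (i * j) / 2) * (2 ^ (j * (n - i - j)) / 2))"
      by (subst powr_realpow) (simp_all add: power_add power2_eq_square)
    also have "\<dots> \<le> (real (n choose j) * real ((n - j) choose i)) * ((2 ^ i - 1) ^ j * (2 ^ j - 1) ^ (n - i - j))"
      by (rule mult_mono[OF bin mult_mono[OF hb1 hb2]]) simp_all
    also have "\<dots> = real (n choose i) * real ((n - i) choose j) * (2 ^ i - 1) ^ j * (2 ^ j - 1) ^ (n - i - j)"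
      using choose_swap[OF ij(3)] by (simp flip: of_nat_mult)
    also have "\<dots> \<le> (\<Sum>j=1..n-i. real (n choose i) * real ((n - i) choose j) * (2 ^ i - 1) ^ j * (2 ^ j - 1) ^ (n - i - j))"
      using ij by (intro member_le_sum[where f = "\<lambda>j. real (n choose i) * real ((n - i) choose j) * (2 ^ i - 1) ^ j * (2 ^ j - 1) ^ (n - i - j)"]) auto
    also have "\<dots> \<le> real (layer_count n)"
      unfolding real_layer_count
      using ij by (intro member_le_sum[where f = "\<lambda>i. \<Sum>j=1..n-i. real (n choose i) * real ((n - i) choose j) * (2 ^ i - 1) ^ j * (2 ^ j - 1) ^ (n - i - j)"] sum_nonneg) auto
    finally show ?case .
  qed
qed

text \<open>All error terms together are at most
  \<open>(C' + 1) * rate n * 2 powr (- gain * n)\<close>. Half of \<open>gain\<close> makes up for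
  the polynomial distance between \<open>rate\<close> and the double sum, and the other half sends
  the relative error to 0.\<close>

lemma G_layer_count_limit: "(\<lambda>n. real (G n) / real (layer_count n)) \<longlonglongrightarrow> 1"
proof -
  have gain: "gain > 0" by (simp add: gain_def)
  obtain C where C: "\<And>n. real (tame_count n) \<le> C * rate n" using tame_count_bounded by blast
  define C' where "C' = max C 0"
  have C': "real (tame_count n) \<le> C' * rate n" "C' \<ge> 0" for n
  proof -
    have "C * rate n \<le> C' * rate n" using rate_pos[of n] by (intro mult_right_mono) (auto simp: C'_def)
    then show "real (tame_count n) \<le> C' * rate n" using C[of n] by linarith
  qed (simp add: C'_def)
  have "eventually (\<lambda>n. 8 * (real n + 1) ^ 2 \<le> 2 powr (gain / 2 * n)) sequentially"
    using gain by (intro power_le_exponential) simp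
  with tame_count_recursion layer_count_lower eventually_ge_at_top[of 1]
  have ev: "eventually (\<lambda>n. 1 \<le> real (G n) / real (layer_count n)
      \<and> real (G n) / real (layer_count n) \<le> 1 + (C' + 1) * 2 powr (- (gain / 2) * n)) sequentially"
  proof eventually_elim
    case (elim n)
    let ?L = "real (layer_count n)"
    have pos: "8 * (real n + 1) ^ 2 > 0" by simp
    have "rate n * 2 powr (- (gain / 2) * n) \<le> rate n / (8 * (real n + 1) ^ 2)"
      using elim(4) rate_pos[of n] pos by (simp add: powr_minus field_simps)
    then have L: "rate n * 2 powr (- (gain / 2) * n) \<le> ?L" using elim(2) by linarith
    moreover have "rate n * 2 powr (- (gain / 2) * n) > 0" using rate_pos[of n] by simp
    ultimately have Lpos: "?L > 0" by linarith
    have "2 powr ((1/2 - gain) * n) = 2 powr (n / 2) * 2 powr (- gain * n)"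
      unfolding powr_add[symmetric] by (simp add: algebra_simps)
    then have "real (tame_count (n - 1)) * 2 powr ((1/2 - gain) * n) \<le> (C' * rate (n - 1)) * (2 powr (n / 2) * 2 powr (- gain * n))"
      using C'(1)[of "n - 1"] by (simp add: mult_right_mono)
    also have "\<dots> = C' * (rate (n - 1) * 2 powr (n / 2)) * 2 powr (- gain * n)" by simp
    also have "\<dots> \<le> C' * rate n * 2 powr (- gain * n)"
      using rate_step[OF elim(3)] C'(2) by (intro mult_right_mono mult_left_mono) auto
    finally have "real (tame_count n) \<le> ?L + (C' + 1) * (rate n * 2 powr (- gain * n))"
      using elim(1) card_layered_rels[of "{0..<n}"] by (simp add: algebra_simps)
    also have "rate n * 2 powr (- gain * n) = (rate n * 2 powr (- (gain / 2) * n)) * 2 powr (- (gain / 2) * n)"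
      by (simp add: mult.assoc powr_add[symmetric])
    also have "(C' + 1) * \<dots> \<le> (C' + 1) * (?L * 2 powr (- (gain / 2) * n))"
      using L C'(2) by (intro mult_left_mono mult_right_mono) auto
    finally have "real (G n) \<le> ?L * (1 + (C' + 1) * 2 powr (- (gain / 2) * n))"
      using G_le_tame_count[of n] by (simp add: algebra_simps)
    moreover have "?L \<le> real (G n)"
      using layer_count_le_card_games[of "{0..<n}"] unfolding G_def by simp
    ultimately show ?case using Lpos by (simp add: pos_divide_le_eq pos_le_divide_eq mult.commute)
  qed
  have "(\<lambda>n. 2 powr (- (gain / 2) * real n)) \<longlonglongrightarrow> 0"
  proof -
    have "(2::real) powr (- (gain / 2) * real n) = (2 powr (- (gain / 2))) ^ n" for n
      by (simp add: powr_power mult.commute)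
    moreover have "(\<lambda>n. (2 powr (- (gain / 2))) ^ n) \<longlonglongrightarrow> (0::real)"
      using gain by (intro LIMSEQ_realpow_zero) (auto simp: powr_less_one)
    ultimately show ?thesis by simp
  qed
  then have "(\<lambda>n. 1 + (C' + 1) * 2 powr (- (gain / 2) * real n)) \<longlonglongrightarrow> 1 + (C' + 1) * 0"
    by (intro tendsto_intros)
  then have up: "(\<lambda>n. 1 + (C' + 1) * 2 powr (- (gain / 2) * real n)) \<longlonglongrightarrow> 1" by simp
  show ?thesis
    using ev by (intro tendsto_sandwich[OF _ _ tendsto_const up]) (auto elim: eventually_mono)
qed

theorem theorem4p1:
  shows "(\<lambda>n. real (G n) /
     (\<Sum>i=1..n. \<Sum>j=1..n-i. real (n choose i) * real ((n-i) choose j)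
        * (2 ^ i - 1) ^ j * (2 ^ j - 1) ^ (n-i-j)))
     \<longlonglongrightarrow> 1"
  using G_layer_count_limit unfolding real_layer_count .

end
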